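(* There is an absolute constant $c>0$ such that the following holds for every prime $p$. Let $X\subseteq\mathbb F_p^2$ and let $\mathcal L$ consist of $t\ge1$ distinct lines in $\mathbb F_p^2$. If every line in $\mathcal L$ contains at least $s$ points of $X$, where $s\ge2$ is an integer, then $$|X|\ge c\min\{s^{3/2}t^{1/2},\ st,\ sp\}.$$
   Context: Lines are affine lines in $\mathbb F_p^2$. *)

theory Defs
  imports Complex_Main "HOL-Number_Theory.Residues"
begin

definition affine_plane :: "('a, 'm) ring_scheme \<Rightarrow> ('a \<times> 'a) set" where
  "affine_plane R = carrier R \<times> carrier R"

definition affine_line :: "('a, 'm) ring_scheme \<Rightarrow> ('a \<times> 'a) set \<Rightarrow> bool" where
  "affine_line R l \<longleftrightarrow>
     (\<exists>a\<in>carrier R. \<exists>b\<in>carrier R. \<exists>c\<in>carrier R.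
        (a, b) \<noteq> (\<zero>\<^bsub>R\<^esub>, \<zero>\<^bsub>R\<^esub>) \<and>
        l = {(x, y) \<in> affine_plane R. a \<otimes>\<^bsub>R\<^esub> x \<oplus>\<^bsub>R\<^esub> b \<otimes>\<^bsub>R\<^esub> y = c})"

(* The prime is quantified inside the statement, below the absolute constant, so F_p cannot be
   a type depending on p; it is the ring of residues with carrier {0..p - 1}. *)
abbreviation prime_field :: "nat \<Rightarrow> int ring" where
  "prime_field p \<equiv> residue_ring (int p)"

end

theory Submission
  imports Defs "Berlekamp_Zassenhaus.Finite_Field" "Jordan_Normal_Form.Determinant"
begin

text \<open>
  A Stepanov argument on the flag variety. A flag is a point (x, y) together with a slope m. If the
  lines were too numerous, then after discarding points and lines every line would carry at least
  8 \<open>\<sigma>\<close> points and every point at least 8 \<open>\<kappa>\<close> lines, with at most 4 \<open>\<kappa>\<^sup>2\<close> \<open>\<sigma>\<close> lines. Counting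
  parameters, some nonzero f(x, y, m) of degree about \<open>\<kappa>\<close> \<open>\<sigma>\<close> in m and about \<open>\<sigma>\<close> along every lifted
  line (a line with its own slope) vanishes on all of these to order about \<open>\<sigma>\<close> in the direction of m.

  Vanishing then propagates back and forth. If f vanishes to order r along the fibres over the
  points, then on each line the low coefficients in m - m0 have more zeros than their degree allows,
  so f vanishes there to order about r \<open>\<sigma>\<close> in m. Over a point, the part of f of order r is thus a
  family of polynomials in m, indexed polynomially by a slope w, whose member at w vanishes to high
  order at w for many w; a Wronskian estimate, valid because the degree in m is less than p, forces
  it to be zero, so f vanishes to order r + 1. After about \<open>\<kappa>\<close> rounds f vanishes identically over
  each line, hence is zero. The degree condition is exactly what |X| < c s p provides once the
  number of lines has been cut down to about |X|^2 / s^3.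
\<close>

section \<open>A Wronskian estimate\<close>

lemma linear_power_dvd_degree:
  fixes q :: "'a::field poly"
  assumes "finite S" "q \<noteq> 0" "\<And>x. x \<in> S \<Longrightarrow> [:-x, 1:] ^ r dvd q"
  shows "r * card S \<le> degree q"
proof (cases "r = 0")
  case False
  have ord: "r \<le> order x q" if "x \<in> S" for x
    using order_divides[of x r q] assms that by auto
  have sub: "S \<subseteq> {x. poly q x = 0}"
  proof
    fix x assume "x \<in> S"
    thus "x \<in> {x. poly q x = 0}" using ord[of x] False assms(2) by (auto simp: order_root)
  qed
  have "r * card S = (\<Sum>x\<in>S. r)" by simp
  also have "\<dots> \<le> (\<Sum>x\<in>S. order x q)" by (rule sum_mono) (rule ord)
  also have "\<dots> \<le> (\<Sum>x | poly q x = 0. order x q)"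
    by (rule sum_mono2) (use sub poly_roots_finite[OF assms(2)] in auto)
  also have "\<dots> \<le> degree q" using assms(2) by (rule sum_order_le_degree)
  finally show ?thesis .
qed auto

text \<open>While the degree of the remainder lies in \<open>D\<close>, its leading term cancels
  against the \<open>v d\<close> of that degree, which lowers the degree.\<close>

lemma reduce_by_distinct_degrees:
  fixes g :: "'a::field poly"
  assumes "finite D" and v: "\<And>d. d \<in> D \<Longrightarrow> v d \<noteq> 0 \<and> degree (v d) = d"
  shows "\<exists>c g'. g = (\<Sum>d\<in>D. smult (c d) (v d)) + g' \<and>
           (g' = 0 \<or> degree g' \<notin> D) \<and> degree g' \<le> degree g"
proof (induction "degree g" arbitrary: g rule: less_induct)
  case less
  show ?case
  proof (cases "g = 0 \<or> degree g \<notin> D")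
    case True
    thus ?thesis by (intro exI[of _ "\<lambda>_. 0"] exI[of _ g]) auto
  next
    case False
    define n where "n = degree g"
    define a where "a = lead_coeff g / lead_coeff (v n)"
    define h where "h = g - smult a (v n)"
    have n: "n \<in> D" "v n \<noteq> 0" "degree (v n) = n" using False v[of n] n_def by auto
    have g: "g = smult a (v n) + h" by (simp add: h_def)
    have "coeff (v n) n \<noteq> 0" using n by (metis leading_coeff_0_iff)
    moreover have "lead_coeff g = coeff g n" by (simp add: n_def)
    ultimately have ch: "coeff h n = 0" using n(3) by (simp add: h_def a_def)
    have dh: "degree h \<le> n" unfolding h_def
      by (rule degree_diff_le) (use n n_def in auto)
    show ?thesis
    proof (cases "h = 0")
      case True
      have "g = (\<Sum>d\<in>D. smult (if d = n then a else 0) (v d)) + 0"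
      proof -
        have "(\<Sum>d\<in>D. smult (if d = n then a else 0) (v d)) = (\<Sum>d\<in>{n}. smult a (v d))"
          by (rule sum.mono_neutral_cong_right) (use assms(1) n in auto)
        thus ?thesis using g True by simp
      qed
      thus ?thesis by (intro exI[of _ "\<lambda>d. if d = n then a else 0"] exI[of _ 0]) auto
    next
      case hn0: False
      have "degree h < n"
        using dh ch hn0 by (metis leading_coeff_0_iff order_le_less)
      from less.hyps[OF this[unfolded n_def]] obtain c g' where c: "h = (\<Sum>d\<in>D. smult (c d) (v d)) + g'"
        "g' = 0 \<or> degree g' \<notin> D" "degree g' \<le> degree h" by blast
      have "(\<Sum>d\<in>D. smult ((c(n := c n + a)) d) (v d)) =
            (\<Sum>d\<in>D. smult (c d) (v d) + (if d = n then smult a (v d) else 0))"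
        by (rule sum.cong) (auto simp: smult_add_left)
      also have "\<dots> = (\<Sum>d\<in>D. smult (c d) (v d)) + smult a (v n)"
        using assms(1) n(1) by (simp add: sum.distrib)
      finally have "g = (\<Sum>d\<in>D. smult ((c(n := c n + a)) d) (v d)) + g'"
        using g c(1) by simp
      thus ?thesis using c dh n_def by (intro exI[of _ "c(n := c n + a)"] exI[of _ g']) auto
    qed
  qed
qed

text \<open>Horner's scheme on the outer coefficients: each new constant coefficient is reduced
  modulo the \<open>v d\<close> found so far, and a nonzero remainder joins them with a degree not
  yet used. So every outer coefficient adds at most one member, whence the bound on
  \<open>card D\<close>.\<close>

lemma distinct_degree_decomposition:
  fixes V :: "'a::field poly poly"
  assumes "V \<noteq> 0" and deg: "\<And>j. degree (coeff V j) \<le> A"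
  shows "\<exists>D u v. D \<subseteq> {..A} \<and> D \<noteq> {} \<and> card D \<le> Suc (degree V) \<and>
    (\<forall>d\<in>D. v d \<noteq> 0 \<and> degree (v d) = d \<and> u d \<noteq> 0 \<and> degree (u d) \<le> degree V) \<and>
    (\<forall>w. poly V [:w:] = (\<Sum>d\<in>D. smult (poly (u d) w) (v d :: 'a poly)))"
proof -
  have "(\<forall>j. degree (coeff V j) \<le> A) \<longrightarrow> V = 0 \<or> ?thesis"
  proof (induction V rule: pCons_induct)
    case (pCons a V)
    show ?case
    proof (intro impI disjI2)
      assume dA: "\<forall>j. degree (coeff (pCons a V) j) \<le> A"
      have da: "degree a \<le> A" using dA[rule_format, of 0] by simp
      have dV: "\<forall>j. degree (coeff V j) \<le> A" 
        using dA by (metis coeff_pCons_Suc)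
      obtain D u v where D: "D \<subseteq> {..A}" "card D \<le> (if V = 0 then 0 else Suc (degree V))"
        and uv: "\<And>d. d\<in>D \<Longrightarrow> v d \<noteq> 0 \<and> degree (v d) = d \<and> u d \<noteq> 0 \<and> degree (u d) \<le> degree V"
        and rep: "\<And>w. poly V [:w:] = (\<Sum>d\<in>D. smult (poly (u d) w) (v d :: 'a poly))"
        and V0: "V = 0 \<Longrightarrow> D = {}" and VD: "V \<noteq> 0 \<Longrightarrow> D \<noteq> {}"
      proof (cases "V = 0")
        case True
        thus thesis by (intro that[of "{}"]) auto
      next
        case False
        with pCons.IH dV obtain D u v where "D \<subseteq> {..A}" "D \<noteq> {}" "card D \<le> Suc (degree V)"
          "(\<forall>d\<in>D. v d \<noteq> 0 \<and> degree (v d) = d \<and> u d \<noteq> 0 \<and> degree (u d) \<le> degree V)"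
          "(\<forall>w. poly V [:w:] = (\<Sum>d\<in>D. smult (poly (u d) w) (v d :: 'a poly)))"
            by blast
        thus thesis using False by (intro that[of D v u]) auto
      qed
      have fD: "finite D" using D(1) finite_subset by blast
      obtain c g' where g: "a = (\<Sum>d\<in>D. smult (c d) (v d)) + g'"
           "g' = 0 \<or> degree g' \<notin> D" "degree g' \<le> degree a"
        using reduce_by_distinct_degrees[OF fD, of v a] uv by blast
      \<comment> \<open>Old members keep a nonzero coefficient, now w times \<open>u d\<close> plus
        \<open>c d\<close>; the new member \<open>g'\<close> enters with coefficient 1.\<close>
      define u' where "u' d = (if d \<in> D then pCons (c d) (u d) else 1)" for d
      define D' where "D' = (if g' = 0 then D else insert (degree g') D)"
      define v' where "v' d = (if d \<in> D then v d else g')" for d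
      have 1: "D' \<subseteq> {..A}" using D g(3) da by (auto simp: D'_def)
      have 2: "D' \<noteq> {}"
      proof
        assume "D' = {}"
        hence "D = {}" "g' = 0" by (auto simp: D'_def split: if_splits)
        with g(1) VD have "a = 0" "V = 0" by auto
        with pCons.hyps show False by auto
      qed
      have 3: "card D' \<le> Suc (degree (pCons a V))"
      proof (cases "V = 0")
        case True
        thus ?thesis using V0 by (auto simp: D'_def)
      next
        case False
        have "card D' \<le> Suc (card D)" using fD by (auto simp: D'_def card_insert_if)
        also have "\<dots> \<le> Suc (Suc (degree V))" using D False by auto
        finally show ?thesis using False by simp
      qed
      have 4: "\<forall>d\<in>D'. v' d \<noteq> 0 \<and> degree (v' d) = d \<and> u' d \<noteq> 0 \<and> degree (u' d) \<le> degree (pCons a V)"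
      proof
        fix d assume d: "d \<in> D'"
        show "v' d \<noteq> 0 \<and> degree (v' d) = d \<and> u' d \<noteq> 0 \<and> degree (u' d) \<le> degree (pCons a V)"
        proof (cases "d \<in> D")
          case True
          hence "V \<noteq> 0" using V0 by auto
          thus ?thesis using uv[OF True] True by (auto simp: u'_def v'_def)
        next
          case False
          thus ?thesis using d by (auto simp: u'_def v'_def D'_def split: if_splits)
        qed
      qed
      have 5: "poly (pCons a V) [:w:] = (\<Sum>d\<in>D'. smult (poly (u' d) w) (v' d))" for w
      proof -
        have "poly (pCons a V) [:w:] = a + smult w (poly V [:w:])" by simp
        also have "\<dots> = (\<Sum>d\<in>D. smult (c d) (v d) + smult w (smult (poly (u d) w) (v d))) + g'"
          by (subst g(1)) (simp add: rep sum.distrib smult_sum2)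
        also have "(\<Sum>d\<in>D. smult (c d) (v d) + smult w (smult (poly (u d) w) (v d)))
           = (\<Sum>d\<in>D. smult (poly (u' d) w) (v' d))"
          by (rule sum.cong) (auto simp: u'_def v'_def smult_add_left)
        also have "\<dots> + g' = (\<Sum>d\<in>D'. smult (poly (u' d) w) (v' d))"
          using g(2) fD by (auto simp: D'_def u'_def v'_def)
        finally show ?thesis .
      qed
      show "\<exists>D u v. D \<subseteq> {..A} \<and> D \<noteq> {} \<and> card D \<le> Suc (degree (pCons a V)) \<and>
        (\<forall>d\<in>D. v d \<noteq> 0 \<and> degree (v d) = d \<and> u d \<noteq> 0 \<and> degree (u d) \<le> degree (pCons a V)) \<and>
        (\<forall>w. poly (pCons a V) [:w:] = (\<Sum>d\<in>D. smult (poly (u d) w) (v d)))"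
        using 1 2 3 4 5 by blast
    qed
  qed auto
  with assms show ?thesis by blast
qed

lemma coeff_mult_of_degree_le:
  fixes p q :: "'a::comm_semiring_0 poly"
  assumes "degree p \<le> m" "degree q \<le> n"
  shows "coeff (p * q) (m + n) = coeff p m * coeff q n"
proof -
  have "coeff (p * q) (m + n) = (\<Sum>i\<le>m + n. coeff p i * coeff q (m + n - i))"
    by (rule coeff_mult)
  also have "\<dots> = (\<Sum>i\<in>{m}. coeff p i * coeff q (m + n - i))"
  proof (rule sum.mono_neutral_right)
    show "\<forall>i\<in>{..m + n} - {m}. coeff p i * coeff q (m + n - i) = 0"
    proof
      fix i assume i: "i \<in> {..m + n} - {m}"
      show "coeff p i * coeff q (m + n - i) = 0"
      proof (cases "i < m")
        case True
        hence "degree q < m + n - i" using assms(2) by linarith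
        thus ?thesis by (simp add: coeff_eq_0)
      next
        case False
        hence "degree p < i" using i assms(1) by auto
        thus ?thesis by (simp add: coeff_eq_0)
      qed
    qed
  qed auto
  finally show ?thesis by simp
qed

text \<open>Unlike \<^const>\<open>pderiv\<close>, the operator X d/dX does not lower degrees: it multiplies the
  coefficient of X^d by d. Hence the leading coefficients of its iterates on polynomials of distinct
  degrees form a Vandermonde system, and the Wronskian below is nonzero as long as these degrees
  stay distinct in the field.\<close>

definition euler_op :: "'a::field poly \<Rightarrow> 'a poly" where
  "euler_op p = pCons 0 (pderiv p)"

lemma coeff_euler_op_power: "coeff ((euler_op ^^ h) p) n = of_nat n ^ h * coeff p n"
proof (induction h)
  case (Suc h)
  have "coeff (euler_op q) n = of_nat n * coeff q n" for q :: "'a poly"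
    by (cases n) (auto simp: euler_op_def coeff_pderiv)
  thus ?case by (simp add: Suc.IH mult.assoc)
qed simp

lemma degree_euler_op_power: "degree ((euler_op ^^ h) p) \<le> degree p"
  by (rule degree_le) (simp add: coeff_euler_op_power coeff_eq_0)

lemma euler_op_power_sum_smult:
  "(euler_op ^^ h) (\<Sum>i\<in>I. smult (c i) (v i)) = (\<Sum>i\<in>I. smult (c i) ((euler_op ^^ h) (v i)))"
  by (rule poly_eqI) (simp add: coeff_euler_op_power coeff_sum sum_distrib_left mult_ac)

lemma power_dvd_euler_op:
  assumes "[:-x, 1:] ^ M dvd p"
  shows "[:-x, 1:] ^ (M - 1) dvd euler_op p"
proof (cases M)
  case (Suc n)
  then obtain g where g: "p = [:-x, 1:] ^ Suc n * g" using assms unfolding dvd_def by blast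
  have "pderiv p = [:-x, 1:] ^ n * ([:-x, 1:] * pderiv g + smult (of_nat (Suc n)) g)"
    unfolding g pderiv_mult pderiv_power_Suc by (simp add: pderiv_pCons algebra_simps)
  hence "euler_op p = [:0, 1:] * ([:-x, 1:] ^ n * ([:-x, 1:] * pderiv g + smult (of_nat (Suc n)) g))"
    by (simp add: euler_op_def)
  thus ?thesis using Suc by (metis diff_Suc_1 dvd_mult dvd_triv_left)
qed simp

lemma power_dvd_euler_op_power:
  assumes "[:-x, 1:] ^ M dvd p"
  shows "[:-x, 1:] ^ (M - h) dvd (euler_op ^^ h) p"
proof (induction h)
  case (Suc h)
  thus ?case using power_dvd_euler_op[of x "M - h"] by simp
qed (use assms in simp)

lemma of_nat_inj_on_below_CHAR: "inj_on (of_nat :: nat \<Rightarrow> 'a::field) {..<CHAR('a)}"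
  by (rule inj_onI) (auto simp: of_nat_eq_iff_cong_CHAR cong_def)

text \<open>A vanishing determinant gives a nonzero kernel vector of the transpose: polynomials
  \<open>a $ h\<close> that combine the Euler iterates of every \<open>v l\<close> to zero. Top
  coefficients turn this into a scalar polynomial \<open>g\<close> of degree below \<open>q\<close>
  with the \<open>q\<close> distinct roots \<open>degree (v l)\<close>.\<close>

lemma euler_wronskian_nonzero:
  fixes v :: "nat \<Rightarrow> 'a::field poly"
  assumes v: "\<And>l. l < q \<Longrightarrow> v l \<noteq> 0" and inj: "inj_on (\<lambda>l. degree (v l)) {..<q}"
    and small: "\<And>l. l < q \<Longrightarrow> degree (v l) < CHAR('a)"
  shows "det (mat q q (\<lambda>(h, l). (euler_op ^^ h) (v l))) \<noteq> 0"
proof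
  define W where "W = mat q q (\<lambda>(h, l). (euler_op ^^ h) (v l))"
  have W: "W \<in> carrier_mat q q" by (simp add: W_def)
  assume "det (mat q q (\<lambda>(h, l). (euler_op ^^ h) (v l))) = 0"
  hence "det (transpose_mat W) = 0" using det_transpose[OF W] by (simp add: W_def)
  then obtain a where a: "a \<in> carrier_vec q" "a \<noteq> 0\<^sub>v q" "transpose_mat W *\<^sub>v a = 0\<^sub>v q"
    using det_0_iff_vec_prod_zero[of "transpose_mat W" q] W by auto
  have rel: "(\<Sum>h<q. (euler_op ^^ h) (v l) * (a $ h)) = 0" if l: "l < q" for l
  proof -
    have "0 = (transpose_mat W *\<^sub>v a) $ l" using a(3) l by simp
    also have "\<dots> = (\<Sum>h<q. (euler_op ^^ h) (v l) * (a $ h))"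
      using l a(1) W by (simp add: scalar_prod_def W_def atLeast0LessThan)
    finally show ?thesis by simp
  qed
  have ne: "{h. h < q \<and> a $ h \<noteq> 0} \<noteq> {}"
  proof
    assume "{h. h < q \<and> a $ h \<noteq> 0} = {}"
    hence "a = 0\<^sub>v q" using a(1) by (intro eq_vecI) auto
    with a(2) show False by simp
  qed
  define m where "m = Max ((\<lambda>h. degree (a $ h)) ` {..<q})"
  have m: "degree (a $ h) \<le> m" if "h < q" for h unfolding m_def using that
    by (intro Max_ge) auto
  define g where "g = (\<Sum>h<q. monom (coeff (a $ h) m) h)"
  have cg: "coeff g h = (if h < q then coeff (a $ h) m else 0)" for h
    unfolding g_def by (simp add: coeff_sum)
  have g_root: "poly g (of_nat (degree (v l))) = 0" if l: "l < q" for l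
  proof -
    have "0 = coeff (\<Sum>h<q. (euler_op ^^ h) (v l) * (a $ h)) (degree (v l) + m)"
      using rel[OF l] by simp
    also have "\<dots> = (\<Sum>h<q. coeff ((euler_op ^^ h) (v l)) (degree (v l)) * coeff (a $ h) m)"
      unfolding coeff_sum
      by (intro sum.cong refl coeff_mult_of_degree_le degree_euler_op_power m) auto
    also have "\<dots> = lead_coeff (v l) * poly g (of_nat (degree (v l)))"
      by (simp add: g_def poly_sum coeff_euler_op_power poly_monom sum_distrib_left mult_ac)
    finally show ?thesis using v[OF l] by simp
  qed
  have "g = 0"
  proof (rule ccontr)
    assume g0: "g \<noteq> 0"
    have dg: "degree g < q"
    proof -
      have "coeff g (degree g) \<noteq> 0" using g0 by simp
      thus ?thesis using cg[of "degree g"] by (auto split: if_splits)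
    qed
    have "inj_on ((of_nat :: nat \<Rightarrow> 'a) \<circ> (\<lambda>l. degree (v l))) {..<q}"
      by (rule comp_inj_on[OF inj]) (rule inj_on_subset[OF of_nat_inj_on_below_CHAR], use small in auto)
    hence "q = card (((of_nat :: nat \<Rightarrow> 'a) \<circ> (\<lambda>l. degree (v l))) ` {..<q})"
      using card_image by fastforce
    also have "\<dots> \<le> card {x. poly g x = 0}"
      by (rule card_mono) (use poly_roots_finite[OF g0] g_root in auto)
    also have "\<dots> \<le> degree g" by (rule card_poly_roots_bound) (fact g0)
    finally show False using dg by simp
  qed
  have "q > 0" using ne by auto
  \<comment> \<open>As \<open>g = 0\<close>, an entry attaining the degree \<open>m\<close> has zero
    leading coefficient, so it is zero and \<open>m = 0\<close>; then all entries are constants, and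
    zero as well.\<close>
  have "m \<in> (\<lambda>h. degree (a $ h)) ` {..<q}" unfolding m_def using \<open>q > 0\<close>
    by (intro Max_in) auto
  then obtain h0 where h0: "h0 < q" "degree (a $ h0) = m" by auto
  have z: "coeff (a $ h) m = 0" if "h < q" for h using cg[of h] that \<open>g = 0\<close> by simp
  have "a $ h0 = 0" using z[OF h0(1)] h0(2) by auto
  hence "m = 0" using h0(2) by simp
  have "a $ h = 0" if "h < q" for h
    using z[OF that] m[OF that] \<open>m = 0\<close>
    by (metis bot_nat_0.extremum_uniqueI leading_coeff_0_iff)
  thus False using ne by auto
qed

lemma degree_det_le:
  fixes M :: "'a::field poly mat"
  assumes M: "M \<in> carrier_mat n n" and d: "\<And>i j. i < n \<Longrightarrow> j < n \<Longrightarrow> degree (M $$ (i, j)) \<le> A"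
  shows "degree (det M) \<le> n * A"
proof -
  have "degree (signof \<pi> * (\<Prod>i = 0..<n. M $$ (i, \<pi> i))) \<le> n * A"
    if "\<pi> permutes {0..<n}" for \<pi>
  proof -
    have "degree (\<Prod>i = 0..<n. M $$ (i, \<pi> i)) \<le> (\<Sum>i = 0..<n. degree (M $$ (i, \<pi> i)))"
      using degree_prod_sum_le[of "{0..<n}"] by (simp add: o_def)
    also have "\<dots> \<le> (\<Sum>i = 0..<n. A)"
      by (rule sum_mono) (use d that permutes_in_image[OF that] in auto)
    finally show ?thesis by (auto simp: sign_def)
  qed
  thus ?thesis unfolding det_def'[OF M]
    by (intro degree_sum_le) (auto simp: finite_permutations)
qed

text \<open>The specialisations V(w) are linear combinations, with coefficients u_d(w), of the members v_d of a
  basis with distinct degrees. If V(w) vanishes to high order at w, then so does the Wronskian of the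
  v_d, unless all the u_d(w) are zero; comparing with the degree of the Wronskian gives the bound.
  The hypothesis \<open>A < CHAR('a)\<close> is the only point of the argument that needs a prime field.\<close>

lemma polynomial_family_vanishing_bound:
  fixes V :: "'a::field poly poly"
  assumes V0: "V \<noteq> 0" and deg: "\<And>j. degree (coeff V j) \<le> A" and A: "A < CHAR('a)"
    and r: "degree V \<le> r" and S: "finite S"
    and dvd: "\<And>w. w \<in> S \<Longrightarrow> [:-w, 1:] ^ M dvd poly V [:w:]"
  shows "(card S - r) * (M - r) \<le> (r + 1) * A"
proof -
  obtain D u v where D: "D \<subseteq> {..A}" "D \<noteq> {}" "card D \<le> Suc (degree V)"
    and uv: "\<And>d. d\<in>D \<Longrightarrow> v d \<noteq> 0 \<and> degree (v d) = d \<and> u d \<noteq> 0 \<and> degree (u d) \<le> degree V"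
    and rep: "\<And>w. poly V [:w:] = (\<Sum>d\<in>D. smult (poly (u d) w) (v d :: 'a poly))"
    using distinct_degree_decomposition[OF V0 deg] by blast
  define q where "q = card D"
  have fD: "finite D" using D(1) finite_subset by blast
  have q: "q > 0" "q \<le> r + 1" using D fD r by (auto simp: q_def card_gt_0_iff)
  obtain e where e: "bij_betw e {0..<q} D" using ex_bij_betw_nat_finite[OF fD] q_def by blast
  have eD: "e l \<in> D" if "l < q" for l using e that by (auto simp: bij_betw_def)
  define W where "W = mat q q (\<lambda>(h, l). (euler_op ^^ h) (v (e l)))"
  have W: "W \<in> carrier_mat q q" by (simp add: W_def)
  have det0: "det W \<noteq> 0" unfolding W_def
  proof (rule euler_wronskian_nonzero)
    have "inj_on e {..<q}" using e by (auto simp: bij_betw_def atLeast0LessThan)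
    thus "inj_on (\<lambda>l. degree (v (e l))) {..<q}"
      using uv eD by (auto simp: inj_on_def)
    show "v (e l) \<noteq> 0" if "l < q" for l using uv[OF eD[OF that]] by simp
    show "degree (v (e l)) < CHAR('a)" if "l < q" for l using uv[OF eD[OF that]] D(1) A eD[OF that]
      by auto
  qed
  have detdeg: "degree (det W) \<le> q * A"
  proof (rule degree_det_le[OF W])
    fix i j assume ij: "i < q" "j < q"
    have "degree (v (e j)) \<le> A" using uv[OF eD[OF ij(2)]] D(1) eD[OF ij(2)] by auto
    thus "degree (W $$ (i, j)) \<le> A" using ij degree_euler_op_power[of i "v (e j)"]
      by (simp add: W_def)
  qed
  \<comment> \<open>One coefficient is enough: outside its at most \<open>r\<close> roots
    \<open>u (e 0)\<close> can be cancelled at the end.\<close>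
  have u0: "u (e 0) \<noteq> 0" "degree (u (e 0)) \<le> r" using uv[OF eD[OF q(1)]] r by auto
  define S' where "S' = {w \<in> S. poly (u (e 0)) w \<noteq> 0}"
  have fS': "finite S'" using S by (simp add: S'_def)
  have "card S - r \<le> card S'"
  proof -
    have "card S \<le> card (S' \<union> {w. poly (u (e 0)) w = 0})"
      by (rule card_mono) (use fS' poly_roots_finite[OF u0(1)] in \<open>auto simp: S'_def\<close>)
    also have "\<dots> \<le> card S' + card {w. poly (u (e 0)) w = 0}" by (rule card_Un_le)
    also have "card {w. poly (u (e 0)) w = 0} \<le> r"
      using card_poly_roots_bound[OF u0(1)] u0(2) by linarith
    finally show ?thesis by linarith
  qed
  have "[:-w, 1:] ^ (M - r) dvd det W" if w: "w \<in> S'" for w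
  proof -
    define U where "U = vec q (\<lambda>l. [:poly (u (e l)) w:])"
    have U: "U \<in> carrier_vec q" by (simp add: U_def)
    have adj: "adj_mat W \<in> carrier_mat q q" using adj_mat[OF W] by simp
    have WU: "(W *\<^sub>v U) $ h = (euler_op ^^ h) (poly V [:w:])" if h: "h < q" for h
    proof -
      have "(W *\<^sub>v U) $ h = (\<Sum>l = 0..<q. (euler_op ^^ h) (v (e l)) * [:poly (u (e l)) w:])"
        using h by (simp add: W_def U_def scalar_prod_def)
      also have "\<dots> = (\<Sum>l = 0..<q. smult (poly (u (e l)) w) ((euler_op ^^ h) (v (e l))))"
        by (intro sum.cong refl) simp
      also have "\<dots> = (\<Sum>d\<in>D. smult (poly (u d) w) ((euler_op ^^ h) (v d)))"
        using sum.reindex_bij_betw[OF e, of "\<lambda>d. smult (poly (u d) w) ((euler_op ^^ h) (v d))"]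
        by simp
      also have "\<dots> = (euler_op ^^ h) (poly V [:w:])"
        by (simp add: rep euler_op_power_sum_smult)
      finally show ?thesis .
    qed
    \<comment> \<open>Each Euler step costs at most one order, and row \<open>h\<close> takes
      \<open>h < q \<le> r + 1\<close> steps.\<close>
    have WUd: "[:-w, 1:] ^ (M - r) dvd (W *\<^sub>v U) $ h" if h: "h < q" for h
    proof -
      have "[:-w, 1:] ^ (M - h) dvd (W *\<^sub>v U) $ h"
        unfolding WU[OF h]
        by (rule power_dvd_euler_op_power) (use dvd w in \<open>auto simp: S'_def\<close>)
      moreover have "M - r \<le> M - h" using h q(2) by linarith
      ultimately show ?thesis using le_imp_power_dvd dvd_trans by blast
    qed
    \<comment> \<open>Cramer's rule: the adjugate isolates \<open>det W\<close> times each entry of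
      \<open>U\<close>.\<close>
    have "adj_mat W *\<^sub>v (W *\<^sub>v U) = (adj_mat W * W) *\<^sub>v U"
      using adj W U by (simp add: assoc_mult_mat_vec)
    also have "\<dots> = det W \<cdot>\<^sub>v U" unfolding adj_mat(3)[OF W] using U
      by (intro eq_vecI) (auto simp: scalar_prod_left_unit smult_scalar_prod_distrib[of _ q])
    finally have "det W * [:poly (u (e 0)) w:] = (adj_mat W *\<^sub>v (W *\<^sub>v U)) $ 0"
      using q(1) by (simp add: U_def)
    also have "\<dots> = (\<Sum>h = 0..<q. adj_mat W $$ (0, h) * (W *\<^sub>v U) $ h)"
      using adj q(1) W by (simp add: scalar_prod_def)
    finally have eq: "det W * [:poly (u (e 0)) w:] = (\<Sum>h = 0..<q. adj_mat W $$ (0, h) * (W *\<^sub>v U) $ h)" .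
    have "[:-w, 1:] ^ (M - r) dvd det W * [:poly (u (e 0)) w:]"
      unfolding eq by (rule dvd_sum) (use WUd in auto)
    hence "[:-w, 1:] ^ (M - r) dvd smult (poly (u (e 0)) w) (det W)" by simp
    thus ?thesis using w by (simp add: S'_def dvd_smult_iff)
  qed
  from linear_power_dvd_degree[OF fS' det0 this]
  have "(M - r) * card S' \<le> q * A" using detdeg by simp
  also have "\<dots> \<le> (r + 1) * A" using q(2) by (rule mult_right_mono) simp
  finally have *: "(M - r) * card S' \<le> (r + 1) * A" .
  have "(card S - r) * (M - r) \<le> card S' * (M - r)"
    using \<open>card S - r \<le> card S'\<close> by (rule mult_right_mono) simp
  also have "\<dots> = (M - r) * card S'" by (rule mult.commute)
  finally show ?thesis using * by linarith
qed

section \<open>The auxiliary polynomial\<close>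

text \<open>Pigeonhole: there are more coefficient vectors on \<open>I\<close> than value vectors on
  \<open>Z\<close>, so two of them share their values, and their difference is a solution.\<close>

lemma homogeneous_system_nontrivial:
  fixes a :: "'z \<Rightarrow> 'i \<Rightarrow> 'a::{field,finite}"
  assumes I: "finite I" and Z: "finite Z" and less: "card Z < card I"
  shows "\<exists>c. (\<exists>i\<in>I. c i \<noteq> 0) \<and> (\<forall>z\<in>Z. (\<Sum>i\<in>I. c i * a z i) = 0)"
proof -
  define \<Phi> where "\<Phi> c = restrict (\<lambda>z. \<Sum>i\<in>I. c i * a z i) Z" for c
  have two: "1 < CARD('a)"
    using card_mono[of "UNIV :: 'a set" "{0, 1}"] by simp
  have "\<not> inj_on \<Phi> (I \<rightarrow>\<^sub>E UNIV)"
  proof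
    assume "inj_on \<Phi> (I \<rightarrow>\<^sub>E UNIV)"
    moreover have "\<Phi> ` (I \<rightarrow>\<^sub>E UNIV) \<subseteq> Z \<rightarrow>\<^sub>E UNIV"
      by (auto simp: \<Phi>_def)
    ultimately have "card (I \<rightarrow>\<^sub>E (UNIV :: 'a set)) \<le> card (Z \<rightarrow>\<^sub>E (UNIV :: 'a set))"
      by (rule card_inj_on_le) (use Z in \<open>simp add: finite_PiE\<close>)
    hence "CARD('a) ^ card I \<le> CARD('a) ^ card Z" using I Z by (simp add: card_PiE)
    hence "card I \<le> card Z" by (rule power_le_imp_le_exp[OF two])
    thus False using less by simp
  qed
  then obtain c1 c2 where c: "c1 \<in> I \<rightarrow>\<^sub>E UNIV" "c2 \<in> I \<rightarrow>\<^sub>E UNIV" "c1 \<noteq> c2" "\<Phi> c1 = \<Phi> c2"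
    by (auto simp: inj_on_def)
  have "\<exists>i\<in>I. c1 i \<noteq> c2 i" using c(1-3) by (meson PiE_ext)
  moreover have "(\<Sum>i\<in>I. (c1 i - c2 i) * a z i) = 0" if "z \<in> Z" for z
    using fun_cong[OF c(4), of z] that by (simp add: \<Phi>_def algebra_simps sum_subtractf)
  ultimately show ?thesis by (intro exI[of _ "\<lambda>i. c1 i - c2 i"]) auto
qed

lemma degree_linear_power_le: "degree ([:a, b:] ^ n) \<le> n"
proof -
  have "degree ([:a, b:] ^ n) \<le> degree [:a, b:] * n" by (rule degree_power_le)
  also have "\<dots> \<le> 1 * n" by (rule mult_right_mono) (auto simp: degree_pCons_le)
  finally show ?thesis by simp
qed

lemma coeff_linear_power_binomial:
  fixes \<alpha> \<beta> :: "'a::comm_ring_1"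
  shows "coeff ([:\<alpha>, \<beta>:] ^ e) i = of_nat (e choose i) * \<beta> ^ i * \<alpha> ^ (e - i)"
proof (cases "i \<le> e")
  case True
  thus ?thesis by (rule coeff_linear_poly_power)
next
  case False
  hence "degree ([:\<alpha>, \<beta>:] ^ e) < i" using degree_linear_power_le[of \<alpha> \<beta> e]
    by simp
  thus ?thesis using False by (simp add: coeff_eq_0 binomial_eq_0)
qed

section \<open>Multiplicity through Taylor coefficients\<close>

lemma linear_power_dvd_iff_taylor:
  fixes q :: "'a::idom poly"
  shows "[:-a, 1:] ^ M dvd q \<longleftrightarrow> (\<forall>i<M. coeff (pcompose q [:a, 1:]) i = 0)"
proof -
  have "[:-a, 1:] ^ M dvd q \<longleftrightarrow> monom 1 M dvd pcompose q [:a, 1:]"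
  proof
    assume "[:-a, 1:] ^ M dvd q"
    then obtain g where "q = [:-a, 1:] ^ M * g" by (metis dvd_def)
    hence "pcompose q [:a, 1:] = [:0, 1:] ^ M * pcompose g [:a, 1:]"
      by (simp add: pcompose_mult pcompose_hom.hom_power pcompose_pCons)
    thus "monom 1 M dvd pcompose q [:a, 1:]" by (simp add: monom_altdef)
  next
    assume "monom 1 M dvd pcompose q [:a, 1:]"
    then obtain g where g: "pcompose q [:a, 1:] = [:0, 1:] ^ M * g"
      by (auto simp: monom_altdef dvd_def)
    have "q = pcompose (pcompose q [:a, 1:]) [:-a, 1:]"
      by (simp add: pcompose_assoc[symmetric] pcompose_pCons)
    also have "\<dots> = [:-a, 1:] ^ M * pcompose g [:-a, 1:]"
      unfolding g by (simp add: pcompose_mult pcompose_hom.hom_power pcompose_pCons)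
    finally show "[:-a, 1:] ^ M dvd q" by (metis dvd_triv_left)
  qed
  thus ?thesis by (simp add: monom_1_dvd_iff')
qed

text \<open>Linear functionals on the inner polynomials commute with translating the outer variable
  by a scalar. It serves to extract Taylor coefficients in the slope before expanding in x.\<close>

lemma map_poly_linear_pcompose_shift:
  fixes s :: "'a::idom poly \<Rightarrow> 'a"
  assumes add: "\<And>p q. s (p + q) = s p + s q" and smult: "\<And>c p. s (smult c p) = c * s p"
  shows "map_poly s (pcompose p [:[:a:], 1:]) = pcompose (map_poly s p) [:a, 1:]"
proof -
  have s0: "s 0 = 0" using smult[of 0 0] by simp
  show ?thesis
  proof (induction p)
    case (pCons q p)
    have "map_poly s (pcompose (pCons q p) [:[:a:], 1:]) =
          [:s q:] + smult a (map_poly s (pcompose p [:[:a:], 1:])) + pCons 0 (map_poly s (pcompose p [:[:a:], 1:]))"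
      by (rule poly_eqI)
        (auto simp: pcompose_pCons coeff_map_poly s0 add smult coeff_pCons split: nat.splits)
    also have "\<dots> = pcompose (map_poly s (pCons q p)) [:a, 1:]"
      using pCons.hyps by (simp add: pCons.IH map_poly_pCons[OF pCons.hyps] s0 pcompose_pCons)
    finally show ?case .
  qed (simp add: s0)
qed

text \<open>The Hasse derivative: free of the factor \<open>i!\<close>, it detects multiplicities in
  every characteristic.\<close>

definition taylor_coeff :: "'a::idom \<Rightarrow> nat \<Rightarrow> 'a poly \<Rightarrow> 'a" where
  "taylor_coeff a i q = coeff (pcompose q [:a, 1:]) i"

lemma taylor_coeff_add: "taylor_coeff a i (p + q) = taylor_coeff a i p + taylor_coeff a i q"
  by (simp add: taylor_coeff_def pcompose_add)

lemma taylor_coeff_smult: "taylor_coeff a i (smult c p) = c * taylor_coeff a i p"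
  by (simp add: taylor_coeff_def pcompose_smult)

lemma taylor_coeff_0 [simp]: "taylor_coeff a i 0 = 0"
  by (simp add: taylor_coeff_def)

lemma taylor_coeff_sum: "taylor_coeff a i (\<Sum>x\<in>A. f x) = (\<Sum>x\<in>A. taylor_coeff a i (f x))"
  by (induction A rule: infinite_finite_induct) (auto simp: taylor_coeff_add)

lemma dvd_iff_taylor_coeff: "[:-a, 1:] ^ M dvd q \<longleftrightarrow> (\<forall>i<M. taylor_coeff a i q = 0)"
  unfolding taylor_coeff_def by (rule linear_power_dvd_iff_taylor)

definition exponent_box :: "nat \<Rightarrow> nat \<Rightarrow> (nat \<times> nat \<times> nat) set" where
  "exponent_box B E = {..B} \<times> {..E} \<times> {..E}"

text \<open>The auxiliary polynomial f(x, b, m) is the sum of the c (i, j, k) x^i b^j m^k, in the coordinates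
  b = y - m x. On the line y = m0 x + b0 one has b = b0 + (m0 - m) x, and the restriction of f is
  kept as a polynomial in x (outer variable) over the polynomials in m (inner variable). The
  coefficient of x^n is then divisible by (m - m0)^(n - B), so the coefficient of (m - m0)^i has
  degree at most B + i in x.\<close>

definition line_monom :: "'a::field \<times> 'a \<Rightarrow> nat \<times> nat \<times> nat \<Rightarrow> 'a poly poly" where
  "line_monom = (\<lambda>(m, b) (i, j, k). monom 1 i * [:[:b:], [:m, -1:]:] ^ j * [:monom 1 k:])"

definition line_poly :: "nat \<Rightarrow> nat \<Rightarrow> (nat \<times> nat \<times> nat \<Rightarrow> 'a::field) \<Rightarrow> 'a \<times> 'a \<Rightarrow> 'a poly poly" where
  "line_poly B E c l = (\<Sum>t\<in>exponent_box B E. smult [:c t:] (line_monom l t))"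

text \<open>The coefficient, a polynomial in m, of (x - x0)^u (b - (y0 - m x0))^v in the expansion of f along
  the fibre over P = (x0, y0).\<close>

definition fibre_coeff ::
    "nat \<Rightarrow> nat \<Rightarrow> (nat \<times> nat \<times> nat \<Rightarrow> 'a::field) \<Rightarrow> 'a \<times> 'a \<Rightarrow> nat \<Rightarrow> nat \<Rightarrow> 'a poly" where
  "fibre_coeff B E c P u v = (\<Sum>(i, j, k)\<in>exponent_box B E.
     smult (c (i, j, k) * of_nat (i choose u) * fst P ^ (i - u) * of_nat (j choose v))
       ([:snd P, - fst P:] ^ (j - v) * monom 1 k))"

section \<open>Restrictions to lines and expansions along fibres\<close>

lemma finite_exponent_box [simp]: "finite (exponent_box B E)"
  by (simp add: exponent_box_def)

lemma coeff_line_monom: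
  "coeff (line_monom (m, b) (i, j, k)) n =
     (if i \<le> n then of_nat (j choose (n - i)) * [:m, -1:] ^ (n - i) * [:b:] ^ (j - (n - i)) * monom 1 k else 0)"
proof -
  have "line_monom (m, b) (i, j, k) = monom 1 i * smult (monom 1 k) ([:[:b:], [:m, -1:]:] ^ j)"
    by (simp add: line_monom_def)
  thus ?thesis by (simp add: coeff_monom_mult coeff_linear_power_binomial mult_ac)
qed

lemma coeff_line_poly: "coeff (line_poly B E c l) n = (\<Sum>t\<in>exponent_box B E. smult (c t) (coeff (line_monom l t) n))"
  by (simp add: line_poly_def coeff_sum)

lemma power_dvd_coeff_line_poly: "[:- m, 1:] ^ (n - B) dvd coeff (line_poly B E c (m, b)) n"
  unfolding coeff_line_poly
proof (rule dvd_sum)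
  fix t assume "t \<in> exponent_box B E"
  then obtain i j k where t: "t = (i, j, k)" "i \<le> B" by (auto simp: exponent_box_def)
  have "[:- m, 1:] ^ (n - B) dvd [:- m, 1:] ^ (n - i)" using t by (intro le_imp_power_dvd) auto
  also have "[:- m, 1:] ^ (n - i) dvd (- [:- m, 1:]) ^ (n - i)" by (subst power_minus) simp
  finally have "[:- m, 1:] ^ (n - B) dvd [:m, -1:] ^ (n - i)" by simp
  thus "[:- m, 1:] ^ (n - B) dvd smult (c t) (coeff (line_monom (m, b) t) n)"
    unfolding t coeff_line_monom
    by (cases "i \<le> n") (simp_all add: dvd_smult dvd_mult2[OF dvd_mult2[OF dvd_mult]])
qed

lemma degree_coeff_line_poly: "degree (coeff (line_poly B E c l) n) \<le> 2 * E"
  unfolding coeff_line_poly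
proof (rule degree_sum_le)
  fix t assume "t \<in> exponent_box B E"
  then obtain i j k where t: "t = (i, j, k)" "j \<le> E" "k \<le> E"
    by (auto simp: exponent_box_def)
  obtain m b where l: "l = (m, b)" by force
  show "degree (smult (c t) (coeff (line_monom l t) n)) \<le> 2 * E"
  proof (cases "i \<le> n \<and> n - i \<le> j")
    case True
    have "degree (of_nat (j choose (n - i)) * [:m, -1:] ^ (n - i) * [:b:] ^ (j - (n - i)) * monom 1 k)
      \<le> 0 + (n - i) + 0 + k"
      by (intro order.trans[OF degree_mult_le] add_mono degree_linear_power_le degree_monom_le)
        (simp_all add: poly_const_pow)
    also have "\<dots> \<le> 2 * E" using True t by linarith
    finally show ?thesis using True unfolding t l coeff_line_monom
      by (auto intro: le_trans[OF degree_smult_le])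
  next
    case False
    thus ?thesis by (auto simp: l t coeff_line_monom binomial_eq_0)
  qed
qed simp

lemma fibre_coeff_eq_0: "E < v \<Longrightarrow> fibre_coeff B E c P u v = 0"
  unfolding fibre_coeff_def by (intro sum.neutral) (auto simp: exponent_box_def binomial_eq_0)

text \<open>Taking order \<open>v\<close> in b removes \<open>v\<close> factors of degree at most
  one in m. This saving pays for the factor (w - m)^v in
  \<open>degree_coeff_leading_poly\<close>.\<close>

lemma degree_fibre_coeff: "degree (fibre_coeff B E c P u v) \<le> 2 * E - v"
  unfolding fibre_coeff_def
proof (rule degree_sum_le)
  fix t assume "t \<in> exponent_box B E"
  then obtain i j k where t: "t = (i, j, k)" "j \<le> E" "k \<le> E"
    by (auto simp: exponent_box_def)
  show "degree (case t of (i, j, k) \<Rightarrow> smult (c (i, j, k) * of_nat (i choose u) * fst P ^ (i - u) * of_nat (j choose v))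
       ([:snd P, - fst P:] ^ (j - v) * monom 1 k)) \<le> 2 * E - v"
  proof (cases "v \<le> j")
    case True
    have "degree ([:snd P, - fst P:] ^ (j - v) * monom 1 k) \<le> (j - v) + k"
      by (intro order.trans[OF degree_mult_le] add_mono degree_linear_power_le degree_monom_le)
    also have "\<dots> \<le> 2 * E - v" using True t by simp
    finally show ?thesis by (simp add: t le_trans[OF degree_smult_le])
  qed (simp add: t binomial_eq_0)
qed simp

text \<open>With T for the inner variable, along a line of slope \<open>m\<close> through the point
  the coordinate b grows from \<open>y\<close> - T \<open>x\<close> by (m - T) times the increment
  of the abscissa. A term of orders u and v in the fibre expansion thus appears at order u + v with
  the factor (m - T)^v.\<close>

lemma coeff_line_poly_shift:
  assumes "y = m * x + b"
  shows "coeff (pcompose (line_poly B E c (m, b)) [:[:x:], 1:]) r =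
    (\<Sum>v\<le>r. fibre_coeff B E c (x, y) (r - v) v * [:m, -1:] ^ v)"
proof -
  have y: "[:b:] + [:x:] * [:m, -1:] = [:y, -x:]" using assms by (simp add: algebra_simps)
  have mono: "coeff (pcompose (smult [:c t:] (line_monom (m, b) t)) [:[:x:], 1:]) r =
    (\<Sum>v\<le>r. smult (c t * of_nat (i choose (r - v)) * x ^ (i - (r - v)) * of_nat (j choose v))
       ([:y, - x:] ^ (j - v) * monom 1 k) * [:m, -1:] ^ v)" if t: "t = (i, j, k)" for t i j k
  proof -
    have "pcompose (line_monom (m, b) t) [:[:x:], 1:] =
       smult (monom 1 k) ([:[:y, -x:], [:m, -1:]:] ^ j * [:[:x:], 1:] ^ i)"
      unfolding y[symmetric]
      by (simp add: t line_monom_def pcompose_mult pcompose_smult pcompose_hom.hom_power pcompose_pCons monom_altdef mult_ac)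
    hence "coeff (pcompose (smult [:c t:] (line_monom (m, b) t)) [:[:x:], 1:]) r =
       smult (c t) (monom 1 k * (\<Sum>v\<le>r. coeff ([:[:y, -x:], [:m, -1:]:] ^ j) v * coeff ([:[:x:], 1:] ^ i) (r - v)))"
      by (simp add: pcompose_smult coeff_mult)
    also have "\<dots> = (\<Sum>v\<le>r. smult (c t) (monom 1 k * (coeff ([:[:y, -x:], [:m, -1:]:] ^ j) v * coeff ([:[:x:], 1:] ^ i) (r - v))))"
      by (simp add: sum_distrib_left smult_sum2)
    also have "\<dots> = (\<Sum>v\<le>r. smult (c t * of_nat (i choose (r - v)) * x ^ (i - (r - v)) * of_nat (j choose v))
       ([:y, - x:] ^ (j - v) * monom 1 k) * [:m, -1:] ^ v)"
      by (intro sum.cong refl)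
        (simp add: coeff_linear_power_binomial of_nat_poly poly_const_pow mult_ac)
    finally show ?thesis .
  qed
  have "coeff (pcompose (line_poly B E c (m, b)) [:[:x:], 1:]) r =
     (\<Sum>t\<in>exponent_box B E. coeff (pcompose (smult [:c t:] (line_monom (m, b) t)) [:[:x:], 1:]) r)"
    by (simp add: line_poly_def pcompose_sum coeff_sum)
  also have "\<dots> = (\<Sum>t\<in>exponent_box B E. \<Sum>v\<le>r. (case t of (i, j, k) \<Rightarrow> smult (c t * of_nat (i choose (r - v)) * x ^ (i - (r - v)) * of_nat (j choose v))
       ([:y, - x:] ^ (j - v) * monom 1 k)) * [:m, -1:] ^ v)"
    by (intro sum.cong refl) (auto simp: mono split: prod.splits)
  also have "\<dots> = (\<Sum>v\<le>r. fibre_coeff B E c (x, y) (r - v) v * [:m, -1:] ^ v)"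
    unfolding fibre_coeff_def
    by (subst sum.swap) (auto simp: sum_distrib_right intro!: sum.cong split: prod.splits)
  finally show ?thesis .
qed

section \<open>Propagation of vanishing\<close>

text \<open>The outer variable is the slope w of a line through P, on which b - (y0 - m x0) = (w - m) (x - x0):
  this is the coefficient of (x - x0)^r in the restriction of f to that line.\<close>

definition leading_poly ::
    "nat \<Rightarrow> nat \<Rightarrow> (nat \<times> nat \<times> nat \<Rightarrow> 'a::field) \<Rightarrow> 'a \<times> 'a \<Rightarrow> nat \<Rightarrow> 'a poly poly" where
  "leading_poly B E c P r = (\<Sum>v\<le>r. [:fibre_coeff B E c P (r - v) v:] * [:[:0, -1:], 1:] ^ v)"

lemma poly_leading_poly:
  "poly (leading_poly B E c P r) [:w:] = (\<Sum>v\<le>r. fibre_coeff B E c P (r - v) v * [:w, -1:] ^ v)"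
  by (simp add: leading_poly_def poly_sum poly_power)

lemma degree_leading_poly: "degree (leading_poly B E c P r) \<le> r"
  unfolding leading_poly_def
proof (rule degree_sum_le)
  fix v assume "v \<in> {..r}"
  have "degree ([:fibre_coeff B E c P (r - v) v:] * [:[:0, -1:], 1:] ^ v) \<le> 0 + v"
    by (intro order.trans[OF degree_mult_le] add_mono degree_linear_power_le) auto
  thus "degree ([:fibre_coeff B E c P (r - v) v:] * [:[:0, -1:], 1:] ^ v) \<le> r"
    using \<open>v \<in> {..r}\<close> by simp
qed simp

lemma degree_coeff_leading_poly:
  fixes P :: "'a::field \<times> 'a"
  shows "degree (coeff (leading_poly B E c P r) n) \<le> 2 * E"
proof -
  have "degree (fibre_coeff B E c P (r - v) v * coeff ([:[:0, -1:], 1:] ^ v) n) \<le> 2 * E" for v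
  proof (cases "v \<le> E \<and> n \<le> v")
    case True
    have "coeff ([:[:0, -1:], 1:] ^ v) n = (smult (of_nat (v choose n)) ([:0, -1:] ^ (v - n)) :: 'a poly)"
      by (simp add: coeff_linear_power_binomial of_nat_poly)
    hence "degree (coeff ([:[:0, -1:], 1:] ^ v) n :: 'a poly) \<le> v - n"
      by (simp add: order.trans[OF degree_smult_le degree_linear_power_le])
    hence "degree (fibre_coeff B E c P (r - v) v * coeff ([:[:0, -1:], 1:] ^ v) n) \<le> (2 * E - v) + (v - n)"
      by (intro order.trans[OF degree_mult_le] add_mono degree_fibre_coeff)
    also have "\<dots> \<le> 2 * E" using True by linarith
    finally show ?thesis .
  next
    case False
    thus ?thesis by (auto simp: fibre_coeff_eq_0 coeff_linear_power_binomial binomial_eq_0 not_le)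
  qed
  thus ?thesis unfolding leading_poly_def by (auto simp: coeff_sum intro!: degree_sum_le)
qed

text \<open>\<open>leading_poly\<close> is the polynomial \<open>g\<close> with the fibre
  coefficients as its coefficients, composed with w - m, and composing with a nonconstant polynomial
  loses nothing.\<close>

lemma leading_poly_eq_0D:
  assumes "leading_poly B E c P r = 0" "v \<le> r"
  shows "fibre_coeff B E c P (r - v) v = 0"
proof -
  define g where "g = (\<Sum>v\<le>r. monom (fibre_coeff B E c P (r - v) v) v)"
  have "leading_poly B E c P r = pcompose g [:[:0, -1:], 1:]"
    by (simp add: g_def leading_poly_def pcompose_sum monom_altdef pcompose_smult pcompose_hom.hom_power pcompose_pCons)
  hence "g = 0" using assms(1) pcompose_eq_0[of g "[:[:0, -1:], 1:]"] by simp
  moreover have "coeff g v = fibre_coeff B E c P (r - v) v"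
    using assms(2) by (simp add: g_def coeff_sum)
  ultimately show ?thesis by simp
qed

definition vanishes_on_fibre where
  "vanishes_on_fibre B E c r P \<longleftrightarrow> (\<forall>u v. u + v < r \<longrightarrow> fibre_coeff B E c P u v = 0)"

text \<open>\<open>line_poly\<close> is f on the surface of all points of the line with arbitrary
  slopes. The lifted line is the curve in it with slope \<open>fst l\<close>, and \<open>M\<close>
  is the order along that curve.\<close>

definition vanishes_on_line where
  "vanishes_on_line B E c M l \<longleftrightarrow> (\<forall>n. [:- fst l, 1:] ^ M dvd coeff (line_poly B E c l) n)"

text \<open>Lines are coded by slope and intercept, which leaves out the vertical ones;
  \<open>furstenberg_bound_card\<close> treats those separately.\<close>

definition incident :: "'a::field \<times> 'a \<Rightarrow> 'a \<times> 'a \<Rightarrow> bool" where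
  "incident P l \<longleftrightarrow> snd P = fst l * fst P + snd l"

text \<open>The coefficient \<open>h i\<close> of (m - m0)^i in the restriction has degree at most
  \<open>B + i\<close> in x, yet zeros of order \<open>r\<close> at no fewer than \<open>s\<close>
  points. So it is zero while \<open>B + i < s * r\<close>.\<close>

lemma fibre_to_line:
  assumes X: "finite X" "s \<le> card X"
    and van: "\<And>P. P \<in> X \<Longrightarrow> incident P l \<and> vanishes_on_fibre B E c r P"
  shows "vanishes_on_line B E c (s * r - B) l"
proof -
  obtain m b where l: "l = (m, b)" by force
  have inj: "inj_on fst X"
    using van by (intro inj_onI) (auto simp: incident_def prod_eq_iff)
  define h where "h i = map_poly (taylor_coeff m i) (line_poly B E c l)" for i
  have ch: "coeff (h i) n = taylor_coeff m i (coeff (line_poly B E c l) n)" for i n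
    by (simp add: h_def coeff_map_poly)
  have "h i = 0" if i: "i < s * r - B" for i
  proof (rule ccontr)
    assume h0: "h i \<noteq> 0"
    have "degree (h i) \<le> B + i"
    proof (rule degree_le, intro allI impI)
      fix n assume n: "B + i < n"
      have "taylor_coeff m i (coeff (line_poly B E c l) n) = 0"
        using power_dvd_coeff_line_poly[of m n B E c b] n unfolding dvd_iff_taylor_coeff l by simp
      thus "coeff (h i) n = 0" by (simp add: ch)
    qed
    moreover have "r * card (fst ` X) \<le> degree (h i)"
    proof (rule linear_power_dvd_degree)
      show "finite (fst ` X)" "h i \<noteq> 0" using X h0 by auto
      fix x assume "x \<in> fst ` X"
      then obtain P where P: "P \<in> X" "x = fst P" by auto
      have y: "snd P = m * x + b" using van[OF P(1)] P(2) by (auto simp: incident_def l)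
      have "coeff (pcompose (h i) [:x, 1:]) r' = 0" if r': "r' < r" for r'
      proof -
        have "pcompose (h i) [:x, 1:] = map_poly (taylor_coeff m i) (pcompose (line_poly B E c l) [:[:x:], 1:])"
          unfolding h_def
          by (rule map_poly_linear_pcompose_shift[symmetric]) (rule taylor_coeff_add taylor_coeff_smult)+
        hence "coeff (pcompose (h i) [:x, 1:]) r' = taylor_coeff m i (coeff (pcompose (line_poly B E c l) [:[:x:], 1:]) r')"
          by (simp add: coeff_map_poly)
        also have "coeff (pcompose (line_poly B E c l) [:[:x:], 1:]) r' =
            (\<Sum>v\<le>r'. fibre_coeff B E c P (r' - v) v * [:m, -1:] ^ v)"
          using coeff_line_poly_shift[OF y, of B E c r'] P(2) by (simp add: l)
        also have "\<dots> = 0"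
          using van[OF P(1)] r' by (intro sum.neutral) (auto simp: vanishes_on_fibre_def)
        finally show ?thesis by simp
      qed
      thus "[:-x, 1:] ^ r dvd h i" by (simp add: linear_power_dvd_iff_taylor)
    qed
    moreover have "s * r \<le> r * card (fst ` X)"
      using X(2) inj by (simp add: card_image mult.commute)
    ultimately show False using i by linarith
  qed
  hence "\<forall>i<s * r - B. taylor_coeff m i (coeff (line_poly B E c l) n) = 0" for n
    by (metis ch coeff_0)
  thus ?thesis by (simp add: vanishes_on_line_def dvd_iff_taylor_coeff l)
qed

text \<open>For each line through \<open>P\<close>, with slope w, \<open>leading_poly\<close> at w
  is the coefficient of order \<open>r\<close> of f on that line, hence divisible by (m - w)^M.
  There are too many such slopes for \<open>polynomial_family_vanishing_bound\<close> unless
  \<open>leading_poly\<close> is zero.\<close>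

lemma line_to_fibre:
  assumes L: "finite L" "k \<le> card L" and E: "2 * E < CHAR('a::field)"
    and van: "\<And>l. l \<in> L \<Longrightarrow> incident (P :: 'a \<times> 'a) l \<and> vanishes_on_line B E c M l"
    and fib: "vanishes_on_fibre B E c r P"
    and bound: "(r + 1) * (2 * E) < (k - r) * (M - r)"
  shows "vanishes_on_fibre B E c (Suc r) P"
proof -
  obtain x y where P: "P = (x, y)" by force
  have inj: "inj_on fst L"
    using van unfolding inj_on_def incident_def by (metis add_left_cancel prod_eq_iff)
  have "leading_poly B E c P r = 0"
  proof (rule ccontr)
    assume ne: "leading_poly B E c P r \<noteq> 0"
    have "[:-m, 1:] ^ M dvd poly (leading_poly B E c P r) [:m:]" if m: "m \<in> fst ` L" for m
    proof -
      obtain b where l: "(m, b) \<in> L" using m by force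
      have y: "y = m * x + b" using van[OF l] by (simp add: incident_def P)
      have "poly (leading_poly B E c P r) [:m:] = coeff (pcompose (line_poly B E c (m, b)) [:[:x:], 1:]) r"
        unfolding poly_leading_poly coeff_line_poly_shift[OF y] P by simp
      moreover have "[:-m, 1:] ^ M dvd coeff (pcompose (line_poly B E c (m, b)) [:[:x:], 1:]) r"
      proof -
        have "[:[:-m, 1:] ^ M:] dvd line_poly B E c (m, b)"
          using van[OF l] by (simp add: vanishes_on_line_def const_poly_dvd_iff)
        then obtain g where "line_poly B E c (m, b) = smult ([:-m, 1:] ^ M) g"
          by (auto simp: dvd_def)
        thus ?thesis by (simp add: pcompose_smult)
      qed
      ultimately show ?thesis by simp
    qed
    from polynomial_family_vanishing_bound[OF ne degree_coeff_leading_poly E degree_leading_poly _ this]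
    have "(card (fst ` L) - r) * (M - r) \<le> (r + 1) * (2 * E)" using L(1) by simp
    moreover have "(k - r) * (M - r) \<le> (card (fst ` L) - r) * (M - r)"
      using L(2) inj by (intro mult_right_mono) (auto simp: card_image)
    ultimately show False using bound by linarith
  qed
  hence lead: "fibre_coeff B E c P (r - v) v = 0" if "v \<le> r" for v
    using leading_poly_eq_0D that by blast
  show ?thesis unfolding vanishes_on_fibre_def
  proof (intro allI impI)
    fix u v assume uv: "u + v < Suc r"
    show "fibre_coeff B E c P u v = 0"
    proof (cases "u + v = r")
      case True
      hence "u = r - v" "v \<le> r" by auto
      thus ?thesis using lead by simp
    next
      case False
      thus ?thesis using uv fib by (auto simp: vanishes_on_fibre_def)
    qed
  qed
qed

section \<open>Existence and nontriviality of the auxiliary polynomial\<close>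

lemma vanishes_on_line_from_low_coeffs:
  assumes "\<And>i n. i < M \<Longrightarrow> n \<le> B + i \<Longrightarrow> taylor_coeff (fst l) i (coeff (line_poly B E c l) n) = 0"
  shows "vanishes_on_line B E c M l"
  unfolding vanishes_on_line_def dvd_iff_taylor_coeff
proof (intro allI impI)
  fix n i assume i: "i < M"
  obtain m b where l: "l = (m, b)" by force
  show "taylor_coeff (fst l) i (coeff (line_poly B E c l) n) = 0"
  proof (cases "n \<le> B + i")
    case False
    thus ?thesis using power_dvd_coeff_line_poly[of m n B E c b] unfolding dvd_iff_taylor_coeff l
      by simp
  qed (use assms i in blast)
qed

text \<open>Unknowns outnumber conditions: those with \<open>n > B + i\<close> hold automatically,
  which leaves at most \<open>M * (B + M)\<close> per line.\<close>

lemma auxiliary_polynomial_exists: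
  fixes L :: "('a::{field,finite} \<times> 'a) set"
  assumes L: "finite L" and less: "card L * (M * (B + M)) < (B + 1) * (E + 1) ^ 2"
  shows "\<exists>c. (\<exists>t\<in>exponent_box B E. c t \<noteq> 0) \<and> (\<forall>l\<in>L. vanishes_on_line B E c M l)"
proof -
  define Z where "Z = L \<times> (SIGMA i:{..<M}. {..B + i})"
  have "card (SIGMA i:{..<M}. {..B + i}) = (\<Sum>i<M. B + i + 1)" by simp
  also have "\<dots> \<le> (\<Sum>i<M. B + M)" by (rule sum_mono) auto
  finally have "card Z \<le> card L * (M * (B + M))" unfolding Z_def
    by (simp add: card_cartesian_product)
  also have "\<dots> < card (exponent_box B E)"
    using less by (simp add: exponent_box_def card_cartesian_product power2_eq_square)
  finally have lt: "card Z < card (exponent_box B E)" .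
  have "finite Z" using L by (simp add: Z_def)
  then obtain c where c: "\<exists>t\<in>exponent_box B E. c t \<noteq> 0"
    "\<forall>(l, i, n)\<in>Z. (\<Sum>t\<in>exponent_box B E. c t * taylor_coeff (fst l) i (coeff (line_monom l t) n)) = 0"
    using homogeneous_system_nontrivial[OF finite_exponent_box _ lt,
        of "\<lambda>(l, i, n) t. taylor_coeff (fst l) i (coeff (line_monom l t) n)"]
    by (auto simp: case_prod_beta)
  have "vanishes_on_line B E c M l" if "l \<in> L" for l
  proof (rule vanishes_on_line_from_low_coeffs)
    fix i n assume "i < M" "n \<le> B + i"
    hence "(l, i, n) \<in> Z" using that by (simp add: Z_def)
    thus "taylor_coeff (fst l) i (coeff (line_poly B E c l) n) = 0"
      using c(2) by (auto simp: coeff_line_poly taylor_coeff_sum taylor_coeff_smult)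
  qed
  thus ?thesis using c(1) by blast
qed

text \<open>As a polynomial in b alone f has degree at most \<open>E\<close>. A line on which it
  vanishes identically makes b0 + (m0 - m) x a root, and distinct lines give distinct roots.\<close>

lemma line_polys_not_all_zero:
  fixes L :: "('a::field \<times> 'a) set"
  assumes c: "\<exists>t\<in>exponent_box B E. c t \<noteq> 0" and L: "finite L" "E < card L"
    and zero: "\<And>l. l \<in> L \<Longrightarrow> line_poly B E c l = 0"
  shows False
proof -
  \<comment> \<open>\<open>Q\<close> is f with b as outermost variable, x in the middle and the
    slope innermost.\<close>
  define Q where "Q = (\<Sum>(i, j, k)\<in>exponent_box B E. monom (monom (monom (c (i, j, k)) k) i) j)"
  have cQ: "coeff (coeff (coeff Q j) i) k = (if (i, j, k) \<in> exponent_box B E then c (i, j, k) else 0)" for i j k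
  proof -
    have "coeff (coeff (coeff Q j) i) k = (\<Sum>t\<in>exponent_box B E. if t = (i, j, k) then c t else 0)"
      unfolding Q_def coeff_sum by (intro sum.cong refl) (auto split: prod.splits)
    thus ?thesis by simp
  qed
  have Q0: "Q \<noteq> 0"
  proof
    assume "Q = 0"
    moreover from c obtain i j k where "(i, j, k) \<in> exponent_box B E" "c (i, j, k) \<noteq> 0"
      by auto
    ultimately show False using cQ[of j i k] by simp
  qed
  define \<rho> where "\<rho> l = [:[:snd l:], [:fst l, -1:]:]" for l :: "'a \<times> 'a"
  have "inj_on \<rho> L" by (auto simp: inj_on_def \<rho>_def)
  hence "card L = card (\<rho> ` L)" by (simp add: card_image)
  also have "\<dots> \<le> card {z. poly Q z = 0}"
  proof (rule card_mono)
    show "\<rho> ` L \<subseteq> {z. poly Q z = 0}"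
    proof (intro image_subsetI CollectI)
      fix l assume l: "l \<in> L"
      have "poly Q (\<rho> l) = line_poly B E c l"
        unfolding line_poly_def Q_def poly_sum
      proof (intro sum.cong refl)
        fix t assume "t \<in> exponent_box B E"
        obtain i j k where t: "t = (i, j, k)" by (cases t)
        have "monom (monom (c t) k) i = smult [:c t:] (monom 1 i * [:monom 1 k:])"
          by (simp add: smult_monom)
        thus "poly (case t of (i, j, k) \<Rightarrow> monom (monom (monom (c (i, j, k)) k) i) j) (\<rho> l)
          = smult [:c t:] (line_monom l t)"
          by (simp add: t poly_monom line_monom_def case_prod_beta \<rho>_def mult_ac)
      qed
      thus "poly Q (\<rho> l) = 0" using zero[OF l] by simp
    qed
  qed (rule poly_roots_finite[OF Q0])
  also have "\<dots> \<le> degree Q" by (rule card_poly_roots_bound[OF Q0])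
  also have "degree Q \<le> E"
    unfolding Q_def
    by (intro degree_sum_le) (auto simp: exponent_box_def intro!: order.trans[OF degree_monom_le])
  finally show False using L by simp
qed

lemma line_poly_eq_0:
  assumes "vanishes_on_line B E c M l" "2 * E < M"
  shows "line_poly B E c l = 0"
proof (rule poly_eqI)
  fix n
  show "coeff (line_poly B E c l) n = coeff 0 n"
  proof (rule ccontr)
    assume "coeff (line_poly B E c l) n \<noteq> coeff 0 n"
    hence "M \<le> degree (coeff (line_poly B E c l) n)"
      using assms(1) dvd_imp_degree_le[of "[:- fst l, 1:] ^ M"]
      by (auto simp: vanishes_on_line_def degree_linear_power)
    thus False using degree_coeff_line_poly[of B E c l n] assms(2) by linarith
  qed
qed

section \<open>Configurations rich in both points and lines\<close>

lemma incident_unique: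
  assumes "incident P l" "incident P l'" "incident Q l" "incident Q l'" "P \<noteq> Q"
  shows "l = l'"
proof -
  have *: "fst l * fst P + snd l = fst l' * fst P + snd l'" "fst l * fst Q + snd l = fst l' * fst Q + snd l'"
    using assms by (auto simp: incident_def)
  have "(fst l * fst P + snd l) - (fst l * fst Q + snd l) = (fst l' * fst P + snd l') - (fst l' * fst Q + snd l')"
    by (simp only: *)
  hence "(fst l - fst l') * (fst P - fst Q) = 0" by (simp add: algebra_simps)
  moreover have "fst P \<noteq> fst Q" using assms by (auto simp: incident_def prod_eq_iff)
  ultimately have "fst l = fst l'" by simp
  thus ?thesis using * by (simp add: prod_eq_iff)
qed

text \<open>Every point of \<open>l\<close> in \<open>X\<close> carries \<open>k - 1\<close> further
  lines, and those at different points differ, since a line other than \<open>l\<close> meets it at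
  most once.\<close>

lemma card_lines_through_line:
  fixes X L :: "('a::field \<times> 'a) set"
  assumes "finite X" "finite L" "l \<in> L"
    and lines: "s \<le> card {P \<in> X. incident P l}"
    and points: "\<And>P. P \<in> X \<Longrightarrow> k \<le> card {l \<in> L. incident P l}"
  shows "s * (k - 1) \<le> card L"
proof -
  let ?T = "\<lambda>P. {l' \<in> L. incident P l'} - {l}"
  let ?Y = "{P \<in> X. incident P l}"
  have "s * (k - 1) \<le> (\<Sum>P\<in>?Y. k - 1)" using lines by simp
  also have "\<dots> \<le> (\<Sum>P\<in>?Y. card (?T P))"
  proof (rule sum_mono)
    fix P assume P: "P \<in> ?Y"
    have "card (?T P) = card {l' \<in> L. incident P l'} - 1"
      using P assms by (subst card_Diff_singleton) auto
    thus "k - 1 \<le> card (?T P)" using points[of P] P by auto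
  qed
  also have "\<dots> = card (\<Union>P\<in>?Y. ?T P)"
    by (rule card_UN_disjoint[symmetric]) (use assms in \<open>auto dest: incident_unique\<close>)
  also have "\<dots> \<le> card L" by (rule card_mono) (use assms in auto)
  finally show ?thesis .
qed

theorem regular_configuration_bound:
  fixes X L :: "('a::{field,finite} \<times> 'a) set"
  assumes ne: "L \<noteq> {}"
    and lines: "\<And>l. l \<in> L \<Longrightarrow> 8 * \<sigma> \<le> card {P \<in> X. incident P l}"
    and points: "\<And>P. P \<in> X \<Longrightarrow> 8 * \<kappa> \<le> card {l \<in> L. incident P l}"
    and pos: "1 \<le> \<sigma>" "1 \<le> \<kappa>" and small: "8 * \<kappa> * \<sigma> < CHAR('a)"
  shows "4 * \<kappa> ^ 2 * \<sigma> < card L"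
proof (rule ccontr)
  assume "\<not> 4 * \<kappa> ^ 2 * \<sigma> < card L"
  hence few: "card L \<le> 4 * \<kappa> ^ 2 * \<sigma>" by simp
  \<comment> \<open>These values balance the count: order \<open>2 * \<sigma>\<close> along
    \<open>4 * \<kappa> ^ 2 * \<sigma>\<close> lines costs at most \<open>B * E ^ 2\<close>
    conditions.\<close>
  define B E where "B = 2 * \<sigma>" and "E = 4 * \<kappa> * \<sigma>"
  have fin: "finite X" "finite L" by auto
  have "card L * (2 * \<sigma> * (B + 2 * \<sigma>)) \<le> 4 * \<kappa> ^ 2 * \<sigma> * (2 * \<sigma> * (B + 2 * \<sigma>))"
    using few by (rule mult_right_mono) simp
  also have "\<dots> = B * E ^ 2" by (simp add: B_def E_def power2_eq_square)
  also have "\<dots> \<le> B * (E + 1) ^ 2" by (intro mult_left_mono power_mono) auto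
  also have "\<dots> < (B + 1) * (E + 1) ^ 2" by simp
  finally obtain c where c: "\<exists>t\<in>exponent_box B E. c t \<noteq> 0" "\<And>l. l \<in> L \<Longrightarrow> vanishes_on_line B E c (2 * \<sigma>) l"
    using auxiliary_polynomial_exists[OF fin(2), of "2 * \<sigma>" B E] by blast
  have on_line: "vanishes_on_line B E c (8 * \<sigma> * r - B) l"
    if "\<And>P. P \<in> X \<Longrightarrow> vanishes_on_fibre B E c r P" "l \<in> L" for r l
    by (rule fibre_to_line[of "{P \<in> X. incident P l}"]) (use that lines fin in auto)
  \<comment> \<open>The range of \<open>r\<close> is chosen so that \<open>8 * \<kappa> - r\<close>
    is still at least \<open>4 * \<kappa>\<close> in every round.\<close>
  have on_fibre: "vanishes_on_fibre B E c r P" if "r \<le> 4 * \<kappa> + 1" "P \<in> X" for r P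
    using that
  proof (induction r arbitrary: P)
    case 0
    thus ?case by (simp add: vanishes_on_fibre_def)
  next
    case (Suc r)
    \<comment> \<open>The first round starts from the order built into f, as nothing is known on the
      fibres yet; later rounds use the order regained through \<open>on_line\<close>.\<close>
    define M where "M = (if r = 0 then 2 * \<sigma> else 8 * \<sigma> * r - B)"
    have "vanishes_on_line B E c M l" if "l \<in> L" for l
      using that c(2) on_line[of r l] Suc by (auto simp: M_def)
    moreover have "(r + 1) * (2 * E) < (8 * \<kappa> - r) * (M - r)"
    proof (cases "r = 0")
      case True
      thus ?thesis using pos by (simp add: M_def E_def)
    next
      case False
      have "5 * \<sigma> * r + (r + B) \<le> 8 * \<sigma> * r"
      proof -
        have "r \<le> r * \<sigma>" "\<sigma> \<le> r * \<sigma>" using pos False by auto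
        moreover have "8 * \<sigma> * r = 8 * (r * \<sigma>)" "5 * \<sigma> * r = 5 * (r * \<sigma>)"
          by simp_all
        ultimately show ?thesis unfolding B_def by linarith
      qed
      hence "5 * \<sigma> * r \<le> M - r" using False by (simp add: M_def)
      moreover have "4 * \<kappa> \<le> 8 * \<kappa> - r" using Suc.prems(1) by simp
      ultimately have "4 * \<kappa> * (5 * \<sigma> * r) \<le> (8 * \<kappa> - r) * (M - r)"
        by (intro mult_le_mono)
      moreover have "(r + 1) * (2 * E) \<le> (2 * r) * (2 * E)" using False
        by (intro mult_right_mono) auto
      moreover have "(2 * r) * (2 * E) = 16 * (\<kappa> * \<sigma> * r)" "4 * \<kappa> * (5 * \<sigma> * r) = 20 * (\<kappa> * \<sigma> * r)"
        by (simp_all add: E_def)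
      moreover have "0 < \<kappa> * \<sigma> * r" using pos False by simp
      ultimately show ?thesis by linarith
    qed
    ultimately show ?case
      using Suc fin points[OF Suc.prems(2)] small
      by (intro line_to_fibre[of "{l \<in> L. incident P l}" "8 * \<kappa>"]) (auto simp: E_def mult_ac)
  qed
  \<comment> \<open>The order along each line is now about 32 \<kappa> \<sigma>, above the degree
    \<open>2 * E\<close>, which is 8 \<kappa> \<sigma>.\<close>
  have "line_poly B E c l = 0" if "l \<in> L" for l
  proof (rule line_poly_eq_0)
    show "vanishes_on_line B E c (8 * \<sigma> * (4 * \<kappa> + 1) - B) l"
      using on_line on_fibre that by blast
    have "8 * \<sigma> * (4 * \<kappa> + 1) = 32 * (\<kappa> * \<sigma>) + 8 * \<sigma>" "2 * E = 8 * (\<kappa> * \<sigma>)" "0 < \<kappa> * \<sigma>"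
      using pos by (auto simp: E_def algebra_simps)
    thus "2 * E < 8 * \<sigma> * (4 * \<kappa> + 1) - B" using pos unfolding B_def by linarith
  qed
  moreover have "E < card L"
  proof -
    obtain l where "l \<in> L" using ne by auto
    from card_lines_through_line[OF fin this lines[OF this] points]
    have "8 * \<sigma> * (8 * \<kappa> - 1) \<le> card L" by simp
    moreover have "8 * \<sigma> * (7 * \<kappa>) \<le> 8 * \<sigma> * (8 * \<kappa> - 1)" using pos
      by (intro mult_left_mono) auto
    moreover have "8 * \<sigma> * (7 * \<kappa>) = 56 * (\<kappa> * \<sigma>)" "E = 4 * (\<kappa> * \<sigma>)" "0 < \<kappa> * \<sigma>"
      using pos by (auto simp: E_def)
    ultimately show ?thesis by linarith
  qed
  ultimately show False using line_polys_not_all_zero[OF c(1) fin(2)] by blast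
qed

section \<open>Rich lines\<close>

lemma rich_subconfiguration:
  fixes X :: "'x set" and L :: "'l set" and \<alpha> \<beta> :: real
  assumes fin: "finite X" "finite L" and nonneg: "0 \<le> \<alpha>" "0 \<le> \<beta>"
    and many: "\<alpha> * card X + \<beta> * card L < (\<Sum>l\<in>L. real (card {P \<in> X. R P l}))"
  shows "\<exists>X' L'. X' \<subseteq> X \<and> L' \<subseteq> L \<and> L' \<noteq> {} \<and>
    (\<forall>P\<in>X'. \<alpha> \<le> real (card {l \<in> L'. R P l})) \<and> (\<forall>l\<in>L'. \<beta> \<le> real (card {P \<in> X'. R P l}))"
proof -
  define I where "I X' L' = (\<Sum>l\<in>L'. \<Sum>P\<in>X'. of_bool (R P l) :: real)" for X' L'
  \<comment> \<open>In a subconfiguration maximising this weight no point or line is worth deleting.\<close>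
  define w where "w = (\<lambda>(X', L'). I X' L' - \<alpha> * card X' - \<beta> * card L')"
  define C where "C = Pow X \<times> Pow L"
  have C: "finite C" "(X, L) \<in> C" using fin by (auto simp: C_def)
  hence "Max (w ` C) \<in> w ` C" by (intro Max_in) auto
  then obtain Z where Z: "Z \<in> C" "w Z = Max (w ` C)" by auto
  have Z_max: "w Y \<le> w Z" if "Y \<in> C" for Y unfolding Z(2) using C that
    by (intro Max_ge) auto
  obtain X' L' where Z_def: "Z = (X', L')" by force
  have sub: "X' \<subseteq> X" "L' \<subseteq> L" using Z(1) by (auto simp: Z_def C_def)
  have fin': "finite X'" "finite L'" using sub fin finite_subset by auto
  have max: "w (X'', L'') \<le> w (X', L')" if "X'' \<subseteq> X'" "L'' \<subseteq> L'" for X'' L''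
    using Z_max[of "(X'', L'')"] that sub by (auto simp: Z_def C_def)
  have I_swap: "I A C = (\<Sum>P\<in>A. \<Sum>l\<in>C. of_bool (R P l))" for A C
    unfolding I_def by (rule sum.swap)
  have card_P: "(\<Sum>P\<in>A. of_bool (R P l) :: real) = card {P \<in> A. R P l}"
    if "finite A" for A l
    using that by (simp add: sum.If_cases of_bool_def Int_def)
  have card_l: "(\<Sum>l\<in>C. of_bool (R P l) :: real) = card {l \<in> C. R P l}"
    if "finite C" for C P
    using that by (simp add: sum.If_cases of_bool_def Int_def)
  have "I X L = (\<Sum>l\<in>L. real (card {P \<in> X. R P l}))"
    unfolding I_def using card_P[OF fin(1)] by simp
  moreover have "w (X, L) = I X L - \<alpha> * card X - \<beta> * card L" by (simp add: w_def)
  ultimately have "0 < w (X, L)" using many by linarith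
  hence pos: "0 < w (X', L')" using Z_max[OF C(2)] by (simp add: Z_def)
  have "L' \<noteq> {}"
  proof
    assume "L' = {}"
    hence "w (X', L') = - (\<alpha> * card X')" by (simp add: w_def I_def)
    thus False using pos nonneg by (simp add: mult_less_0_iff)
  qed
  moreover have "\<alpha> \<le> real (card {l \<in> L'. R P l})" if P: "P \<in> X'" for P
  proof -
    have "I X' L' = real (card {l \<in> L'. R P l}) + I (X' - {P}) L'"
      unfolding I_swap card_l[OF fin'(2), symmetric] by (rule sum.remove[OF fin'(1) P])
    moreover have "real (card X') = real (card (X' - {P})) + 1"
      using fin' P by (metis Suc_eq_plus1 card_Suc_Diff1 of_nat_Suc add.commute)
    ultimately show ?thesis using max[of "X' - {P}" L'] by (simp add: w_def algebra_simps)
  qed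
  moreover have "\<beta> \<le> real (card {P \<in> X'. R P l})" if l: "l \<in> L'" for l
  proof -
    have "I X' L' = real (card {P \<in> X'. R P l}) + I X' (L' - {l})"
      unfolding I_def card_P[OF fin'(1), symmetric] by (rule sum.remove[OF fin'(2) l])
    moreover have "real (card L') = real (card (L' - {l})) + 1"
      using fin' l by (metis Suc_eq_plus1 card_Suc_Diff1 of_nat_Suc add.commute)
    ultimately show ?thesis using max[of X' "L' - {l}"] by (simp add: w_def algebra_simps)
  qed
  ultimately show ?thesis using sub by blast
qed

text \<open>A new line meets each of the n earlier ones in at most one point, so it adds at least s
  - n points. The sum over n is stated doubled to avoid a division.\<close>

lemma card_points_inclusion_exclusion:
  fixes X L :: "('a::field \<times> 'a) set"
  assumes X: "finite X" and L: "finite L" and rich: "\<And>l. l \<in> L \<Longrightarrow> s \<le> card {P \<in> X. incident P l}"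
  shows "2 * s * card L \<le> 2 * card {P \<in> X. \<exists>l\<in>L. incident P l} + card L * card L"
  using L rich
proof (induction L rule: finite_induct)
  case (insert l L)
  define Y where "Y = {P \<in> X. \<exists>l\<in>L. incident P l}"
  define Y' where "Y' = {P \<in> X. \<exists>l\<in>insert l L. incident P l}"
  define T where "T = {P \<in> X. incident P l}"
  have fin: "finite Y" "finite Y'" "finite T" using X by (auto simp: Y_def Y'_def T_def)
  have "T \<inter> Y \<subseteq> (\<Union>l'\<in>L. {P \<in> X. incident P l \<and> incident P l'})"
    by (auto simp: T_def Y_def)
  hence "card (T \<inter> Y) \<le> card (\<Union>l'\<in>L. {P \<in> X. incident P l \<and> incident P l'})"
    by (rule card_mono[rotated]) (use X insert in auto)
  also have "\<dots> \<le> (\<Sum>l'\<in>L. card {P \<in> X. incident P l \<and> incident P l'})"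
    by (rule card_UN_le) (use insert in auto)
  also have "\<dots> \<le> (\<Sum>l'\<in>L. 1)"
  proof (rule sum_mono)
    fix l' assume "l' \<in> L"
    hence "l \<noteq> l'" using insert by auto
    hence "P = Q" if "incident P l \<and> incident P l'" "incident Q l \<and> incident Q l'" for P Q
      using incident_unique[of P l l' Q] that by auto
    thus "card {P \<in> X. incident P l \<and> incident P l'} \<le> 1"
      using X by (simp add: card_le_Suc0_iff_eq)
  qed
  finally have "card (T \<inter> Y) \<le> card L" by simp
  moreover have "card T + card Y = card Y' + card (T \<inter> Y)"
    using card_Un_Int[OF fin(3) fin(1)]
    by (simp add: T_def Y_def Y'_def Collect_disj_eq[symmetric] conj_disj_distribL[symmetric])
  moreover have "s \<le> card T" using insert.prems by (simp add: T_def)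
  moreover have "2 * s * card L \<le> 2 * card Y + card L * card L" using insert
    by (simp add: Y_def)
  ultimately have "2 * s * card L + 2 * s \<le> 2 * card Y' + (card L * card L + 2 * card L)"
    by linarith
  also have "\<dots> \<le> 2 * card Y' + (card L + 1) * (card L + 1)" by simp
  finally show ?case using insert by (simp add: Y'_def)
qed simp

lemma card_points_few_lines:
  fixes X L :: "('a::field \<times> 'a) set"
  assumes "finite X" "finite L" "\<And>l. l \<in> L \<Longrightarrow> s \<le> card {P \<in> X. incident P l}" "card L \<le> s"
  shows "s * card L \<le> 2 * card X"
proof -
  have "card {P \<in> X. \<exists>l\<in>L. incident P l} \<le> card X"
    by (rule card_mono) (use assms in auto)
  moreover have "card L * card L \<le> s * card L" using assms(4) by (rule mult_right_mono) simp
  moreover have "2 * s * card L = 2 * (s * card L)" by simp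
  ultimately show ?thesis using card_points_inclusion_exclusion[OF assms(1-3)] by linarith
qed

lemma card_lines_le_card_points_squared:
  fixes X L :: "('a::field \<times> 'a) set"
  assumes X: "finite X" and rich: "\<And>l. l \<in> L \<Longrightarrow> 2 \<le> card {P \<in> X. incident P l}"
  shows "card L \<le> card X ^ 2"
proof -
  have "\<exists>P Q. P \<in> X \<and> Q \<in> X \<and> P \<noteq> Q \<and> incident P l \<and> incident Q l"
    if l: "l \<in> L" for l
  proof -
    obtain S where "S \<subseteq> {P \<in> X. incident P l}" "card S = 2"
      using obtain_subset_with_card_n[OF rich[OF l]] by blast
    then obtain P Q where "S = {P, Q}" "P \<noteq> Q" by (meson card_2_iff)
    thus ?thesis using \<open>S \<subseteq> {P \<in> X. incident P l}\<close> by blast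
  qed
  then obtain f g where fg: "\<And>l. l \<in> L \<Longrightarrow> f l \<in> X \<and> g l \<in> X \<and> f l \<noteq> g l \<and> incident (f l) l \<and> incident (g l) l"
    by metis
  have "inj_on (\<lambda>l. (f l, g l)) L"
  proof (rule inj_onI)
    fix l l' assume "l \<in> L" "l' \<in> L" "(f l, g l) = (f l', g l')"
    thus "l = l'" using incident_unique[of "f l" l l' "g l"] fg[of l] fg[of l'] by auto
  qed
  hence "card L \<le> card (X \<times> X)" by (rule card_inj_on_le) (use fg X in auto)
  thus ?thesis by (simp add: card_cartesian_product power2_eq_square)
qed

text \<open>If the bound failed, one could keep only about N^2 / s^3 lines, N being the number of
  points, and pass to a subconfiguration rich on both sides;
  \<open>regular_configuration_bound\<close> then demands more lines than were kept. Keeping so few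
  makes its degree condition follow from \<open>small\<close>.\<close>

lemma many_rich_lines:
  fixes X L :: "('a::{field,finite} \<times> 'a) set"
  assumes rich: "\<And>l. l \<in> L \<Longrightarrow> s \<le> card {P \<in> X. incident P l}"
    and s: "16 \<le> s" "s \<le> card L" and small: "1024 * card X < s * CHAR('a)"
  shows "s ^ 3 * card L \<le> 65536 * card X ^ 2"
proof (rule ccontr)
  assume "\<not> ?thesis"
  hence big: "65536 * real (card X) ^ 2 < real s ^ 3 * real (card L)"
    by (metis not_le of_nat_less_iff of_nat_mult of_nat_numeral of_nat_power)
  define N where "N = real (card X)"
  have fin: "finite X" "finite L" by auto
  have spos: "0 < real s" using s by simp
  \<comment> \<open>Just \<open>s\<close> of the lines give this; it ensures
    \<open>1 \<le> z\<close> and \<open>1 \<le> \<alpha> / 8\<close> below.\<close>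
  have sN: "real s ^ 2 \<le> 2 * N"
  proof -
    obtain L0 where L0: "L0 \<subseteq> L" "card L0 = s" using s(2)
      by (metis obtain_subset_with_card_n)
    have "s * card L0 \<le> 2 * card X"
      by (rule card_points_few_lines) (use L0 rich fin finite_subset in auto)
    hence "real (s * s) \<le> real (2 * card X)" using L0 of_nat_mono by metis
    thus ?thesis by (simp add: N_def power2_eq_square)
  qed
  have Npos: "0 < N" using sN spos by (smt (verit) zero_less_power)
  \<comment> \<open>From \<open>z\<close> lines on, \<open>4 * \<kappa> ^ 2 * \<sigma> < t\<close>
    is contradictory, given \<kappa> \<ge> \<alpha>/16 and \<sigma> \<ge> s/32. Rounding up at most
    doubles \<open>z\<close>, whence the 65536 in the claim.\<close>
  define z where "z = 32768 * N ^ 2 / real s ^ 3"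
  define t where "t = nat \<lceil>z\<rceil>"
  have z1: "1 \<le> z"
  proof -
    have "real s ^ 3 * 1 \<le> real s ^ 3 * real s" using s by (intro mult_left_mono) auto
    also have "\<dots> = (real s ^ 2) ^ 2" by (simp add: power2_eq_square power3_eq_cube)
    also have "\<dots> \<le> (2 * N) ^ 2" using sN by (intro power_mono) auto
    also have "\<dots> \<le> 32768 * N ^ 2" by (simp add: power_mult_distrib)
    finally show ?thesis using spos by (simp add: z_def field_simps)
  qed
  have t: "z \<le> real t" "real t \<le> 2 * z" "real t \<le> z + 1" using z1 unfolding t_def
    by linarith+
  have "2 * z < real (card L)" using big spos by (simp add: z_def N_def field_simps)
  hence "t \<le> card L" using t(2) by linarith
  then obtain L1 where L1: "L1 \<subseteq> L" "card L1 = t" by (metis obtain_subset_with_card_n)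
  have tpos: "0 < real t" using t(1) z1 by linarith
  \<comment> \<open>The thresholds then total s t / 4 for the points and s t / 2 for the lines, less
    than the s t incidences available.\<close>
  define \<alpha> where "\<alpha> = real s * real t / (4 * N)"
  have "\<alpha> * card X + real s / 2 * card L1 < real s * real t"
    using Npos spos tpos by (simp add: \<alpha>_def L1 N_def[symmetric] field_simps)
  also have "\<dots> = (\<Sum>l\<in>L1. real s)" by (simp add: L1)
  also have "\<dots> \<le> (\<Sum>l\<in>L1. real (card {P \<in> X. incident P l}))"
    by (rule sum_mono) (use rich L1 in auto)
  finally have "\<alpha> * card X + real s / 2 * card L1 < (\<Sum>l\<in>L1. real (card {P \<in> X. incident P l}))" .
  moreover have "0 \<le> \<alpha>" "0 \<le> real s / 2" "finite L1"
    using Npos spos tpos L1 fin finite_subset by (auto simp: \<alpha>_def)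
  ultimately obtain X' L' where sub: "X' \<subseteq> X" "L' \<subseteq> L1" "L' \<noteq> {}"
    and points: "\<And>P. P \<in> X' \<Longrightarrow> \<alpha> \<le> real (card {l \<in> L'. incident P l})"
    and lines: "\<And>l. l \<in> L' \<Longrightarrow> real s / 2 \<le> real (card {P \<in> X'. incident P l})"
    using rich_subconfiguration[OF fin(1), of L1 \<alpha> "real s / 2" incident] by blast
  define \<sigma> where "\<sigma> = s div 16"
  define \<kappa> where "\<kappa> = nat \<lfloor>\<alpha> / 8\<rfloor>"
  have st: "32768 * N ^ 2 \<le> real t * real s ^ 3" using t(1) spos
    by (simp add: z_def field_simps)
  have alpha8: "1 \<le> \<alpha> / 8"
  proof -
    have "16 * N * real s ^ 2 * 2 \<le> 16 * N * (2 * N) * 2" using sN Npos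
      by (intro mult_mono) auto
    also have "\<dots> \<le> 32768 * N ^ 2" by (simp add: power2_eq_square)
    also note st
    finally have "32 * N * real s ^ 2 \<le> (real t * real s) * real s ^ 2"
      by (simp add: power2_eq_square power3_eq_cube mult_ac)
    hence "32 * N \<le> real t * real s" using spos by (simp add: mult_le_cancel_right)
    thus ?thesis using Npos by (simp add: \<alpha>_def field_simps)
  qed
  have kap: "real \<kappa> \<le> \<alpha> / 8" "\<alpha> / 16 \<le> real \<kappa>" "1 \<le> \<kappa>"
  proof -
    have "1 \<le> \<lfloor>\<alpha> / 8\<rfloor>" using alpha8 by simp
    hence "real \<kappa> = of_int \<lfloor>\<alpha> / 8\<rfloor>" "1 \<le> \<kappa>"
      by (auto simp: \<kappa>_def le_nat_iff)
    thus "real \<kappa> \<le> \<alpha> / 8" "\<alpha> / 16 \<le> real \<kappa>" "1 \<le> \<kappa>"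
      by linarith+
  qed
  have sig: "16 * \<sigma> \<le> s" "s \<le> 32 * \<sigma>" "1 \<le> \<sigma>" using s(1)
    unfolding \<sigma>_def by presburger+
  have "4 * \<kappa> ^ 2 * \<sigma> < card L'"
  proof (rule regular_configuration_bound[OF sub(3)])
    show "8 * \<sigma> \<le> card {P \<in> X'. incident P l}" if "l \<in> L'" for l
      using lines[OF that] sig(1) by linarith
    show "8 * \<kappa> \<le> card {l \<in> L'. incident P l}" if "P \<in> X'" for P
      using points[OF that] kap(1) by linarith
    \<comment> \<open>This computation fixes the constant 1024 in \<open>small\<close>.\<close>
    have "real (8 * \<kappa> * \<sigma>) \<le> 8 * (\<alpha> / 8) * (real s / 16)"
      using kap(1) sig(1) unfolding of_nat_mult by (intro mult_mono) auto
    also have "\<dots> = real s ^ 2 * real t / (64 * N)"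
      by (simp add: \<alpha>_def power2_eq_square)
    also have "\<dots> \<le> real s ^ 2 * (2 * z) / (64 * N)"
      using t(2) Npos by (intro divide_right_mono mult_left_mono) auto
    also have "\<dots> = 1024 * N / real s" using Npos spos
      by (simp add: z_def field_simps power2_eq_square power3_eq_cube)
    also have "\<dots> < real CHAR('a)"
    proof -
      have "real (1024 * card X) < real (s * CHAR('a))" using small of_nat_less_iff by blast
      thus ?thesis using spos by (simp add: N_def field_simps)
    qed
    finally show "8 * \<kappa> * \<sigma> < CHAR('a)" by linarith
  qed (use sig kap in auto)
  also have "card L' \<le> t" using sub(2) L1 fin by (metis card_mono finite_subset)
  finally have "real (4 * \<kappa> ^ 2 * \<sigma>) < real t" by (simp only: of_nat_less_iff)
  moreover have "4 * (\<alpha> / 16) ^ 2 * (real s / 32) \<le> real (4 * \<kappa> ^ 2 * \<sigma>)"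
    using kap(2) sig(2) alpha8 unfolding of_nat_mult of_nat_power
    by (intro mult_mono power_mono) auto
  ultimately have "4 * (\<alpha> / 16) ^ 2 * (real s / 32) < real t" by linarith
  hence "real s ^ 3 * real t ^ 2 < 32768 * N ^ 2 * real t"
    using Npos by (simp add: \<alpha>_def field_simps power2_eq_square power3_eq_cube)
  hence "(real t * real s ^ 3) * real t < (32768 * N ^ 2) * real t"
    by (simp add: power2_eq_square mult_ac)
  hence "real t * real s ^ 3 < 32768 * N ^ 2" using tpos by (simp add: mult_less_cancel_right)
  thus False using st by linarith
qed

text \<open>At most \<open>s\<close> lines are handled by inclusion-exclusion, \<open>s < 16\<close>
  by counting pairs of points, as \<open>s ^ 3\<close> is then bounded, and the rest by the
  polynomial argument.\<close>

lemma rich_lines_trichotomy: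
  fixes X L :: "('a::{field,finite} \<times> 'a) set"
  assumes rich: "\<And>l. l \<in> L \<Longrightarrow> s \<le> card {P \<in> X. incident P l}" and s: "2 \<le> s"
  shows "s * card L \<le> 2 * card X \<or> s * CHAR('a) \<le> 1024 * card X \<or> s ^ 3 * card L \<le> 65536 * card X ^ 2"
proof -
  consider "card L \<le> s" | "s < 16" | "16 \<le> s" "s \<le> card L" by linarith
  thus ?thesis
  proof cases
    case 1
    thus ?thesis using card_points_few_lines[OF _ _ rich] by simp
  next
    case 2
    have "card L \<le> card X ^ 2"
      by (rule card_lines_le_card_points_squared) (use rich s le_trans in \<open>auto, blast\<close>)
    moreover have "s ^ 3 \<le> 16 ^ 3" using 2 by (intro power_mono) auto
    ultimately have "s ^ 3 * card L \<le> 16 ^ 3 * card X ^ 2" by (rule mult_le_mono[rotated])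
    thus ?thesis by simp
  next
    case 3
    thus ?thesis using many_rich_lines[OF rich 3] by force
  qed
qed

section \<open>The prime field\<close>

text \<open>The constants 4 and 131072 are twice those of \<open>rich_lines_trichotomy\<close>, to
  make room for vertical lines.\<close>

definition furstenberg_bound :: "nat \<Rightarrow> bool" where
  "furstenberg_bound p \<longleftrightarrow> (\<forall>X L s. X \<subseteq> affine_plane (prime_field p) \<longrightarrow>
     (\<forall>l\<in>L. affine_line (prime_field p) l) \<longrightarrow> 2 \<le> s \<longrightarrow> (\<forall>l\<in>L. s \<le> card (l \<inter> X)) \<longrightarrow>
     s * card L \<le> 4 * card X \<or> s * p \<le> 1024 * card X \<or> s ^ 3 * card L \<le> 131072 * card X ^ 2)"

text \<open>Reduction is injective on the residues, so the equation can be read in the field. The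
  line is vertical if \<open>b = 0\<close>; otherwise the equation is solved for the second
  coordinate.\<close>

lemma affine_line_mod_ring:
  fixes l :: "(int \<times> int) set"
  assumes "affine_line (prime_field (CARD('n::prime_card))) l"
  defines "e \<equiv> of_int :: int \<Rightarrow> 'n mod_ring"
  shows "(\<exists>w. l = {P \<in> affine_plane (prime_field (CARD('n))). e (fst P) = w}) \<or>
         (\<exists>k. l = {P \<in> affine_plane (prime_field (CARD('n))). incident (map_prod e e P) k})"
proof -
  let ?\<Pi> = "affine_plane (prime_field (CARD('n)))"
  have car: "carrier (prime_field (CARD('n))) = {0..int CARD('n) - 1}"
    by (simp add: residue_ring_def)
  have e_inj: "e x = e y \<longleftrightarrow> x = y"
    if "x \<in> {0..int CARD('n) - 1}" "y \<in> {0..int CARD('n) - 1}" for x y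
    using that by (auto simp: e_def of_int_eq_iff_cong_CHAR cong_def)
  have e_mod: "e (x mod int CARD('n)) = e x" for x
    using of_int_mod_CHAR[where 'a="'n mod_ring", of x] by (simp add: e_def)
  obtain a b c where abc: "a \<in> {0..int CARD('n) - 1}" "b \<in> {0..int CARD('n) - 1}" "c \<in> {0..int CARD('n) - 1}"
    and ab: "(a, b) \<noteq> (0, 0)"
    and l: "l = {(x, y) \<in> ?\<Pi>. (a * x mod int CARD('n) + b * y mod int CARD('n)) mod int CARD('n) = c}"
    using assms(1) unfolding affine_line_def car by (auto simp: residue_ring_def)
  have "(a * x mod int CARD('n) + b * y mod int CARD('n)) mod int CARD('n) = c \<longleftrightarrow> e a * e x + e b * e y = e c" for x y
  proof -
    have "(a * x + b * y) mod int CARD('n) = c \<longleftrightarrow> e ((a * x + b * y) mod int CARD('n)) = e c"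
      by (rule e_inj[symmetric]) (use abc in auto)
    thus ?thesis unfolding e_mod by (simp add: mod_simps e_def)
  qed
  hence l_e: "l = {P \<in> ?\<Pi>. e a * e (fst P) + e b * e (snd P) = e c}"
    unfolding l by auto
  show ?thesis
  proof (cases "b = 0")
    case True
    have "e a \<noteq> 0" using ab True e_inj[of a 0] abc by (auto simp: e_def)
    hence "e a * e (fst P) + e b * e (snd P) = e c \<longleftrightarrow> e (fst P) = e c / e a" for P :: "int \<times> int"
      using True by (auto simp: e_def field_simps)
    thus ?thesis unfolding l_e by auto
  next
    case False
    have eb: "e b \<noteq> 0" using False e_inj[of b 0] abc by (auto simp: e_def)
    have "e a * e (fst P) + e b * e (snd P) = e c \<longleftrightarrow> incident (map_prod e e P) (- e a / e b, e c / e b)" for P :: "int \<times> int"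
    proof -
      have "incident (map_prod e e P) (- e a / e b, e c / e b) \<longleftrightarrow> e (snd P) = (e c - e a * e (fst P)) / e b"
        by (simp add: incident_def diff_divide_distrib)
      also have "\<dots> \<longleftrightarrow> e a * e (fst P) + e b * e (snd P) = e c"
        using eb by (auto simp: eq_divide_eq algebra_simps)
      finally show ?thesis by simp
    qed
    thus ?thesis unfolding l_e by blast
  qed
qed

text \<open>The vertical lines \<open>V\<close> are pairwise disjoint, so
  \<open>s * card V \<le> card X\<close>; the others satisfy \<open>rich_lines_trichotomy\<close>.
  The larger class holds at least half of the lines.\<close>

lemma furstenberg_bound_card: "furstenberg_bound (CARD('n::prime_card))"
  unfolding furstenberg_bound_def
proof (intro allI impI)
  fix X :: "(int \<times> int) set" and L s
  let ?\<Pi> = "affine_plane (prime_field (CARD('n)))"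
  assume X: "X \<subseteq> ?\<Pi>" and lines: "\<forall>l\<in>L. affine_line (prime_field (CARD('n))) l"
    and s: "2 \<le> s" and rich: "\<forall>l\<in>L. s \<le> card (l \<inter> X)"
  define e where "e = (of_int :: int \<Rightarrow> 'n mod_ring)"
  define f where "f = map_prod e e"
  have \<Pi>: "?\<Pi> = {0..int CARD('n) - 1} \<times> {0..int CARD('n) - 1}"
    by (simp add: affine_plane_def residue_ring_def)
  have "inj_on e {0..int CARD('n) - 1}"
    by (auto simp: inj_on_def e_def of_int_eq_iff_cong_CHAR cong_def)
  hence f_inj: "inj_on f ?\<Pi>" unfolding \<Pi> f_def by (simp add: map_prod_inj_on)
  have fin_plane: "finite ?\<Pi>" unfolding \<Pi> by simp
  have fin: "finite X" by (rule finite_subset[OF X fin_plane])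
  have "L \<subseteq> Pow ?\<Pi>" using lines by (auto simp: affine_line_def)
  hence finL: "finite L" using fin_plane finite_subset by blast
  define V where "V = {l \<in> L. \<exists>w. l = {P \<in> ?\<Pi>. e (fst P) = w}}"
  define U where "U = L - V"
  have finUV: "finite U" "finite V" using finL by (auto simp: U_def V_def)
  have "s * card V \<le> card X"
  proof -
    have "s * card V = (\<Sum>l\<in>V. s)" by simp
    also have "\<dots> \<le> (\<Sum>l\<in>V. card (l \<inter> X))"
      by (rule sum_mono) (use rich in \<open>auto simp: V_def\<close>)
    also have "\<dots> = card (\<Union>l\<in>V. l \<inter> X)"
      by (rule card_UN_disjoint[symmetric]) (use finUV fin in \<open>auto simp: V_def\<close>)
    also have "\<dots> \<le> card X" by (rule card_mono) (use fin in auto)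
    finally show ?thesis .
  qed
  moreover have "\<exists>k. l = {P \<in> ?\<Pi>. incident (f P) k}" if "l \<in> U" for l
    using affine_line_mod_ring[where 'n='n, of l] lines that by (auto simp: U_def V_def e_def f_def)
  then obtain g where g: "\<And>l. l \<in> U \<Longrightarrow> l = {P \<in> ?\<Pi>. incident (f P) (g l)}"
    by metis
  have g_inj: "inj_on g U" by (rule inj_onI) (metis g)
  have "s * card U \<le> 2 * card X \<or> s * CARD('n) \<le> 1024 * card X \<or> s ^ 3 * card U \<le> 65536 * card X ^ 2"
  proof -
    have "s \<le> card {Q \<in> f ` X. incident Q k}" if "k \<in> g ` U" for k
    proof -
      obtain l where l: "l \<in> U" "k = g l" using \<open>k \<in> g ` U\<close> by auto
      have "l \<inter> X = {P \<in> X. incident (f P) k}" using g[OF l(1)] X l(2) by auto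
      moreover have "{Q \<in> f ` X. incident Q k} = f ` {P \<in> X. incident (f P) k}" by auto
      moreover have "inj_on f {P \<in> X. incident (f P) k}" using f_inj X
        by (auto intro: inj_on_subset)
      ultimately have "card {Q \<in> f ` X. incident Q k} = card (l \<inter> X)"
        by (simp add: card_image)
      thus ?thesis using rich l by (auto simp: U_def)
    qed
    from rich_lines_trichotomy[where L = "g ` U" and X = "f ` X", OF this s]
    show ?thesis using card_image[OF g_inj] card_image[OF inj_on_subset[OF f_inj X]] by simp
  qed
  moreover have "card L = card U + card V" using finL
    by (simp add: U_def V_def card_Diff_subset card_mono)
  ultimately show "s * card L \<le> 4 * card X \<or> s * CARD('n) \<le> 1024 * card X \<or> s ^ 3 * card L \<le> 131072 * card X ^ 2"
  proof (cases "card U \<le> card V")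
    case True
    have "s * card L \<le> s * (2 * card V)" using True \<open>card L = _\<close>
      by (intro mult_left_mono) auto
    moreover have "s * (2 * card V) = 2 * (s * card V)" by simp
    ultimately show ?thesis using \<open>s * card V \<le> card X\<close> by linarith
  next
    case False
    have "s * card L \<le> s * (2 * card U)" "s ^ 3 * card L \<le> s ^ 3 * (2 * card U)"
      using False \<open>card L = _\<close> by (intro mult_left_mono; simp)+
    moreover have "s * (2 * card U) = 2 * (s * card U)" "s ^ 3 * (2 * card U) = 2 * (s ^ 3 * card U)"
      by simp_all
    ultimately show ?thesis using \<open>s * card U \<le> 2 * card X \<or> _\<close> by linarith
  qed
qed

text \<open>The polynomial argument needs a field type with p elements, while a type cannot depend on p. It is
  enough to have one such type for a prime at which the bound fails, if there is one.\<close>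

definition exceptional_prime :: nat where
  "exceptional_prime = (if \<exists>p. prime p \<and> \<not> furstenberg_bound p
     then SOME p. prime p \<and> \<not> furstenberg_bound p else 2)"

text \<open>The default 2 keeps the value prime when there is no counterexample, so the type below
  always has prime cardinality.\<close>

lemma prime_exceptional_prime: "prime exceptional_prime"
proof (cases "\<exists>p. prime p \<and> \<not> furstenberg_bound p")
  case True
  thus ?thesis using someI_ex[OF True] by (simp add: exceptional_prime_def)
next
  case False
  thus ?thesis unfolding exceptional_prime_def if_not_P[OF False] by simp
qed

typedef exceptional = "{..<exceptional_prime}"
  using prime_gt_0_nat[OF prime_exceptional_prime] by auto

lemma CARD_exceptional: "CARD(exceptional) = exceptional_prime"
  using type_definition.card[OF type_definition_exceptional] by simp

instance exceptional :: prime_card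
  by standard (simp add: CARD_exceptional prime_exceptional_prime)

lemma furstenberg_bound_prime:
  assumes "prime p"
  shows "furstenberg_bound p"
proof (rule ccontr)
  assume "\<not> furstenberg_bound p"
  hence ex: "\<exists>p. prime p \<and> \<not> furstenberg_bound p" using assms by blast
  from someI_ex[OF this] have "\<not> furstenberg_bound exceptional_prime"
    using ex by (simp add: exceptional_prime_def)
  thus False using furstenberg_bound_card[where 'n=exceptional] by (simp add: CARD_exceptional)
qed

theorem corollary12:
  "\<exists>c::real. c > 0 \<and>
     (\<forall>(p::nat) (X :: (int \<times> int) set) (L :: (int \<times> int) set set) (s::nat) (t::nat).
        prime p \<longrightarrow>
        X \<subseteq> affine_plane (prime_field p) \<longrightarrow>
        (\<forall>l\<in>L. affine_line (prime_field p) l) \<longrightarrow>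
        card L = t \<longrightarrow> t \<ge> 1 \<longrightarrow>
        s \<ge> 2 \<longrightarrow>
        (\<forall>l\<in>L. card (l \<inter> X) \<ge> s) \<longrightarrow>
        real (card X) \<ge>
          c * Min {real s powr (3/2) * real t powr (1/2), real s * real t, real s * real p})"
proof (intro exI[of _ "1 / 1024"] conjI allI impI)
  fix p X L and s t :: nat
  assume p: "prime p" and X: "X \<subseteq> affine_plane (prime_field p)"
    and L: "\<forall>l\<in>L. affine_line (prime_field p) l" and t: "card L = t" "1 \<le> t"
    and s: "2 \<le> s" and rich: "\<forall>l\<in>L. s \<le> card (l \<inter> X)"
  let ?M = "Min {real s powr (3/2) * real t powr (1/2), real s * real t, real s * real p}"
  have le: "?M \<le> real s powr (3/2) * real t powr (1/2)" "?M \<le> real s * real t" "?M \<le> real s * real p"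
    by (auto intro!: Min_le)
  from furstenberg_bound_prime[OF p] X L s rich t(1)
  consider "s * t \<le> 4 * card X" | "s * p \<le> 1024 * card X" | "s ^ 3 * t \<le> 131072 * card X ^ 2"
    unfolding furstenberg_bound_def by blast
  thus "1 / 1024 * ?M \<le> real (card X)"
  proof cases
    case 1
    hence "real s * real t \<le> 4 * real (card X)"
      by (metis of_nat_le_iff of_nat_mult of_nat_numeral)
    thus ?thesis using le by simp
  next
    case 2
    hence "real s * real p \<le> 1024 * real (card X)"
      by (metis of_nat_le_iff of_nat_mult of_nat_numeral)
    thus ?thesis using le by simp
  next
    case 3
    \<comment> \<open>Squaring removes the half powers. As 131072 is below 1024^2, the constant
      1/1024 dictated by the second alternative serves here too.\<close>
    hence "real (s ^ 3 * t) \<le> real (131072 * card X ^ 2)" by (simp only: of_nat_le_iff)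
    also have "\<dots> \<le> (1024 * real (card X)) ^ 2" by (simp add: power_mult_distrib)
    finally have "real s ^ 3 * real t \<le> (1024 * real (card X)) ^ 2" by simp
    moreover have "(real s powr (3/2) * real t powr (1/2)) ^ 2 = real s ^ 3 * real t"
      using s t by (simp add: power_mult_distrib powr_half_sqrt[symmetric] powr_power powr_numeral)
    ultimately have "(real s powr (3/2) * real t powr (1/2)) ^ 2 \<le> (1024 * real (card X)) ^ 2"
      by simp
    hence "real s powr (3/2) * real t powr (1/2) \<le> 1024 * real (card X)"
      by (rule power2_le_imp_le) simp
    thus ?thesis using le by simp
  qed
qed simp

end
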